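(* The following categories have the dual Ramsey property: (1) the category $\mathbf{EDig}_{srq}$ whose objects are finite reflexive digraphs with linear extensions and whose morphisms are strong rigid quotient maps; (2) the category $\mathbf{EPos}_{srq}$ whose objects are finite posets with linear extensions and whose morphisms are strong rigid quotient maps.
   Context: A reflexive digraph with a linear extension is a triple $(A,\rho,\sqsubset)$ where $\rho\subseteq A^2$ is reflexive, $\sqsubset$ is a (strict) linear order on $A$, and $(x,y)\in\rho$ with $x\ne y$ implies $x\sqsubset y$. A poset with a linear extension is such a triple in which moreover $\rho$ is a partial order (reflexive, antisymmetric, transitive). Rigid surjection: a surjection $f$ between finite chains $(X,<)\to(Y,<')$ such that $\min f^{-1}(x)<\min f^{-1}(y)$ whenever $x<'y$. For a finite chain $(A,\sqsubset)$ and distinct $X,Y\subseteq A$ put $X\sqsubset_{alex}Y$ iff $X\subsetneq Y$, or $X,Y$ are incomparable under inclusion and $\max(X\setminus Y)\sqsubset\max(Y\setminus X)$. For a reflexive digraph with a linear extension $(A,\rho,\sqsubset)$, the set $\rho$ is linearly ordered by $\sqsubset_{sal}$: every pair $(a,a)$ precedes every pair $(a_1,a_2)$ with $a_1\neq a_2$; and if $(a_1,a_2),(b_1,b_2)\in\rho$ are both of the form $(a,a)$, or both have distinct coordinates, then $(a_1,a_2)\sqsubset_{sal}(b_1,b_2)$ iff $\{a_1,a_2\}\sqsubset_{alex}\{b_1,b_2\}$. A strong rigid quotient map from $(A,\rho,\sqsubset)$ to $(A',\rho',\sqsubset')$ is a map $f:A\to A'$ that is a homomorphism ($(x,y)\in\rho\Rightarrow(f(x),f(y))\in\rho'$)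 and such that the induced map $\hat f:(\rho,\sqsubset_{sal})\to(\rho',\sqsubset'_{sal})$, $\hat f(x,y)=(f(x),f(y))$, is a rigid surjection. A category $\mathbf C$ has the dual Ramsey property if for every integer $k\ge2$ and all objects $\mathcal A,\mathcal B$ with $\hom_{\mathbf C}(\mathcal B,\mathcal A)\neq\varnothing$ there is an object $\mathcal C$ such that for every coloring $\chi:\hom_{\mathbf C}(\mathcal C,\mathcal A)\to\{1,\ldots,k\}$ there is $w\in\hom_{\mathbf C}(\mathcal C,\mathcal B)$ such that $\chi$ is constant on $\{f\cdot w: f\in\hom_{\mathbf C}(\mathcal B,\mathcal A)\}$. *)

theory Defs
  imports "HOL-Library.FuncSet" "HOL-Library.Infinite_Typeclass"
begin

subsection \<open>Categories and the dual Ramsey property\<close>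

text \<open>\<open>Comp \<C> X Y Z g f\<close> is the composite \<open>g \<cdot> f : X \<rightarrow> Y \<rightarrow> Z\<close>. The objects are arguments
  of \<open>Comp\<close> because an arrow, represented by a set-theoretic function, does not record its
  codomain.\<close>

record ('o, 'm) cat =
  Ob :: "'o set"
  Hom :: "'o \<Rightarrow> 'o \<Rightarrow> 'm set"
  Comp :: "'o \<Rightarrow> 'o \<Rightarrow> 'o \<Rightarrow> 'm \<Rightarrow> 'm \<Rightarrow> 'm"

locale category =
  fixes \<C> :: "('o, 'm) cat"
  assumes comp_closed: "\<lbrakk>X \<in> Ob \<C>; Y \<in> Ob \<C>; Z \<in> Ob \<C>; f \<in> Hom \<C> X Y; g \<in> Hom \<C> Y Z\<rbrakk>
      \<Longrightarrow> Comp \<C> X Y Z g f \<in> Hom \<C> X Z"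
    and comp_assoc: "\<lbrakk>W \<in> Ob \<C>; X \<in> Ob \<C>; Y \<in> Ob \<C>; Z \<in> Ob \<C>;
        f \<in> Hom \<C> W X; g \<in> Hom \<C> X Y; h \<in> Hom \<C> Y Z\<rbrakk>
      \<Longrightarrow> Comp \<C> W Y Z h (Comp \<C> W X Y g f) = Comp \<C> W X Z (Comp \<C> X Y Z h g) f"
    and ex_identity: "X \<in> Ob \<C> \<Longrightarrow> \<exists>i \<in> Hom \<C> X X.
        (\<forall>Y \<in> Ob \<C>. (\<forall>f \<in> Hom \<C> X Y. Comp \<C> X X Y f i = f) \<and>
                    (\<forall>f \<in> Hom \<C> Y X. Comp \<C> Y X X i f = f))"

definition dual_ramsey :: "('o, 'm) cat \<Rightarrow> bool" where
  "dual_ramsey \<C> \<longleftrightarrow>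
    (\<forall>k::nat. k \<ge> 2 \<longrightarrow>
      (\<forall>A \<in> Ob \<C>. \<forall>B \<in> Ob \<C>. Hom \<C> B A \<noteq> {} \<longrightarrow>
        (\<exists>C \<in> Ob \<C>. \<forall>\<chi> \<in> Hom \<C> C A \<rightarrow> {1..k}.
          \<exists>w \<in> Hom \<C> C B. \<exists>c. \<forall>f \<in> Hom \<C> B A. \<chi> (Comp \<C> C B A f w) = c)))"


subsection \<open>Rigid surjections of finite chains\<close>

text \<open>A chain is a set together with the relation of a strict linear order on it.
  The minimum is unspecified if it does not exist, in particular for the empty set.\<close>

definition strict_chain :: "'a set \<Rightarrow> 'a rel \<Rightarrow> bool" where
  "strict_chain A r \<longleftrightarrow> r \<subseteq> A \<times> A \<and> strict_linear_order_on A r"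

definition chain_min :: "'a rel \<Rightarrow> 'a set \<Rightarrow> 'a" where
  "chain_min r S = (THE m. m \<in> S \<and> (\<forall>s \<in> S. s \<noteq> m \<longrightarrow> (m, s) \<in> r))"

definition chain_max :: "'a rel \<Rightarrow> 'a set \<Rightarrow> 'a" where
  "chain_max r S = chain_min (r\<inverse>) S"

definition rigid_surjection :: "'a set \<Rightarrow> 'a rel \<Rightarrow> 'b set \<Rightarrow> 'b rel \<Rightarrow> ('a \<Rightarrow> 'b) \<Rightarrow> bool" where
  "rigid_surjection X r Y s f \<longleftrightarrow>
    f ` X = Y \<and>
    (\<forall>x \<in> Y. \<forall>y \<in> Y. (x, y) \<in> s \<longrightarrow>
      (chain_min r {u \<in> X. f u = x}, chain_min r {u \<in> X. f u = y}) \<in> r)"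


subsection \<open>Reflexive digraphs and posets with linear extensions\<close>

record 'a linext_digraph =
  verts :: "'a set"
  arcs :: "'a rel"
  lin :: "'a rel"

definition reflexive_digraph_linext :: "'a linext_digraph \<Rightarrow> bool" where
  "reflexive_digraph_linext A \<longleftrightarrow>
    arcs A \<subseteq> verts A \<times> verts A \<and> refl_on (verts A) (arcs A) \<and>
    strict_chain (verts A) (lin A) \<and>
    (\<forall>x y. (x, y) \<in> arcs A \<and> x \<noteq> y \<longrightarrow> (x, y) \<in> lin A)"

definition poset_linext :: "'a linext_digraph \<Rightarrow> bool" where
  "poset_linext A \<longleftrightarrow> reflexive_digraph_linext A \<and> partial_order_on (verts A) (arcs A)"

definition alex :: "'a set \<Rightarrow> 'a rel \<Rightarrow> 'a set rel" where
  "alex A r = {(X, Y). X \<subseteq> A \<and> Y \<subseteq> A \<and>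
    (X \<subset> Y \<or> \<not> X \<subseteq> Y \<and> \<not> Y \<subseteq> X \<and> (chain_max r (X - Y), chain_max r (Y - X)) \<in> r)}"

definition sal :: "'a linext_digraph \<Rightarrow> ('a \<times> 'a) rel" where
  "sal A = {((a1, a2), (b1, b2)). (a1, a2) \<in> arcs A \<and> (b1, b2) \<in> arcs A \<and>
    (a1 = a2 \<and> b1 \<noteq> b2 \<or>
     (a1 = a2 \<longleftrightarrow> b1 = b2) \<and> ({a1, a2}, {b1, b2}) \<in> alex (verts A) (lin A))}"

text \<open>Maps out of \<open>verts A\<close> are extensional, so that they are counted once in a hom-set.\<close>

definition strong_rigid_quotient ::
    "'a linext_digraph \<Rightarrow> 'b linext_digraph \<Rightarrow> ('a \<Rightarrow> 'b) \<Rightarrow> bool" where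
  "strong_rigid_quotient A B f \<longleftrightarrow>
    f \<in> verts A \<rightarrow>\<^sub>E verts B \<and>
    (\<forall>x y. (x, y) \<in> arcs A \<longrightarrow> (f x, f y) \<in> arcs B) \<and>
    rigid_surjection (arcs A) (sal A) (arcs B) (sal B) (\<lambda>(x, y). (f x, f y))"

text \<open>Vertices are drawn from an arbitrary infinite type, so that every isomorphism class of
  finite structures is represented.\<close>

definition EDig_srq :: "('a::infinite linext_digraph, 'a \<Rightarrow> 'a) cat" where
  "EDig_srq = \<lparr>
    Ob = {A. finite (verts A) \<and> reflexive_digraph_linext A},
    Hom = (\<lambda>A B. {f. strong_rigid_quotient A B f}),
    Comp = (\<lambda>A B C g f. compose (verts A) g f)\<rparr>"

definition EPos_srq :: "('a::infinite linext_digraph, 'a \<Rightarrow> 'a) cat" where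
  "EPos_srq = \<lparr>
    Ob = {A. finite (verts A) \<and> poset_linext A},
    Hom = (\<lambda>A B. {f. strong_rigid_quotient A B f}),
    Comp = (\<lambda>A B C g f. compose (verts A) g f)\<rparr>"


subsection \<open>Well-definedness\<close>

lemma chain_min_eqI:
  assumes "strict_chain A r" "m \<in> S" "\<And>s. s \<in> S \<Longrightarrow> s \<noteq> m \<Longrightarrow> (m, s) \<in> r"
  shows "chain_min r S = m"
  unfolding chain_min_def
proof (rule the_equality)
  fix m' assume m': "m' \<in> S \<and> (\<forall>s\<in>S. s \<noteq> m' \<longrightarrow> (m', s) \<in> r)"
  show "m' = m"
  proof (rule ccontr)
    assume "m' \<noteq> m"
    then have "(m, m') \<in> r" "(m', m) \<in> r" using m' assms by auto
    then show False using assms(1)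
      unfolding strict_chain_def strict_linear_order_on_def irrefl_def trans_def by blast
  qed
qed (use assms in auto)

lemma chain_ex_min:
  assumes "strict_chain A r" "finite S" "S \<noteq> {}" "S \<subseteq> A"
  shows "\<exists>m \<in> S. \<forall>s \<in> S. s \<noteq> m \<longrightarrow> (m, s) \<in> r"
  using assms(2-4)
proof (induction S rule: finite_ne_induct)
  case (singleton x) then show ?case by auto
next
  case (insert x F)
  then obtain m where m: "m \<in> F" "\<forall>s \<in> F. s \<noteq> m \<longrightarrow> (m, s) \<in> r" by auto
  have tr: "trans r" and tot: "total_on A r"
    using assms(1) unfolding strict_chain_def strict_linear_order_on_def by auto
  have "x \<noteq> m" "x \<in> A" "m \<in> A" using insert m by auto
  then consider "(x, m) \<in> r" | "(m, x) \<in> r" using tot unfolding total_on_def by blast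
  then show ?case
  proof cases
    case 1
    then have "\<forall>s \<in> insert x F. s \<noteq> x \<longrightarrow> (x, s) \<in> r" using m tr unfolding trans_def by (metis insertE)
    then show ?thesis by blast
  next
    case 2
    then have "\<forall>s \<in> insert x F. s \<noteq> m \<longrightarrow> (m, s) \<in> r" using m by blast
    then show ?thesis using m by blast
  qed
qed

lemma chain_min_props:
  assumes "strict_chain A r" "finite S" "S \<noteq> {}" "S \<subseteq> A"
  shows "chain_min r S \<in> S" "\<And>s. s \<in> S \<Longrightarrow> s \<noteq> chain_min r S \<Longrightarrow> (chain_min r S, s) \<in> r"
proof -
  obtain m where m: "m \<in> S" "\<forall>s \<in> S. s \<noteq> m \<longrightarrow> (m, s) \<in> r" using chain_ex_min[OF assms] by blast
  then have "chain_min r S = m" using chain_min_eqI[OF assms(1)] by blast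
  then show "chain_min r S \<in> S" "\<And>s. s \<in> S \<Longrightarrow> s \<noteq> chain_min r S \<Longrightarrow> (chain_min r S, s) \<in> r"
    using m by auto
qed

lemma strict_chain_converse: "strict_chain A r \<Longrightarrow> strict_chain A (r\<inverse>)"
  unfolding strict_chain_def strict_linear_order_on_def irrefl_def by auto

lemma chain_max_eqI:
  assumes "strict_chain A r" "m \<in> S" "\<And>s. s \<in> S \<Longrightarrow> s \<noteq> m \<Longrightarrow> (s, m) \<in> r"
  shows "chain_max r S = m"
  unfolding chain_max_def by (rule chain_min_eqI[OF strict_chain_converse]) (use assms in auto)

text \<open>On arcs with the same type of coordinates, \<open>sal\<close> compares second coordinates first and
  breaks ties by first coordinates; hence it is a strict linear order.\<close>

lemma sal_iff:
  assumes A: "reflexive_digraph_linext A" and a: "(a1, a2) \<in> arcs A" and b: "(b1, b2) \<in> arcs A"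
  shows "((a1, a2), (b1, b2)) \<in> sal A \<longleftrightarrow>
    a1 = a2 \<and> b1 \<noteq> b2 \<or>
    (a1 = a2 \<longleftrightarrow> b1 = b2) \<and> ((a2, b2) \<in> lin A \<or> a2 = b2 \<and> (a1, b1) \<in> lin A)"
proof -
  let ?r = "lin A"
  have c: "strict_chain (verts A) ?r" using A unfolding reflexive_digraph_linext_def by auto
  have tr: "\<And>x y z. (x, y) \<in> ?r \<Longrightarrow> (y, z) \<in> ?r \<Longrightarrow> (x, z) \<in> ?r" and irr: "\<And>x. (x, x) \<notin> ?r"
    and tot: "\<And>x y. x \<in> verts A \<Longrightarrow> y \<in> verts A \<Longrightarrow> x \<noteq> y \<Longrightarrow> (x, y) \<in> ?r \<or> (y, x) \<in> ?r"
    using c unfolding strict_chain_def strict_linear_order_on_def trans_def irrefl_def total_on_def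
    by blast+
  have V: "a1 \<in> verts A" "a2 \<in> verts A" "b1 \<in> verts A" "b2 \<in> verts A"
    and la: "a1 \<noteq> a2 \<Longrightarrow> (a1, a2) \<in> ?r" and lb: "b1 \<noteq> b2 \<Longrightarrow> (b1, b2) \<in> ?r"
    using A a b unfolding reflexive_digraph_linext_def by auto
  have sing: "chain_max ?r {x} = x" for x by (rule chain_max_eqI[OF c]) auto
  have pair: "chain_max ?r {x, y} = y" if "(x, y) \<in> ?r" for x y
    by (rule chain_max_eqI[OF c]) (use that in auto)
  consider "a1 = a2" "b1 = b2" | "a1 = a2" "b1 \<noteq> b2" | "a1 \<noteq> a2" "b1 = b2"
    | "a1 \<noteq> a2" "b1 \<noteq> b2" by blast
  then show ?thesis
  proof cases
    case 1
    then show ?thesis using a b V sing irr by (cases "a1 = b1") (auto simp: sal_def alex_def)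
  next
    case 4
    note l = la[OF 4(1)] lb[OF 4(2)]
    consider "a1 = b1" "a2 = b2" | "a1 = b1" "a2 \<noteq> b2" | "a1 \<noteq> b1" "a2 = b2"
      | "a1 \<noteq> b1" "a2 \<noteq> b2" "a1 = b2" | "a1 \<noteq> b1" "a2 \<noteq> b2" "a2 = b1"
      | "a1 \<noteq> b1" "a2 \<noteq> b2" "a1 \<noteq> b2" "a2 \<noteq> b1" by blast
    then show ?thesis
    proof cases
      case 1 then show ?thesis using irr by (auto simp: sal_def alex_def)
    next
      case c2: 2
      then have "{a1, a2} - {b1, b2} = {a2}" "{b1, b2} - {a1, a2} = {b2}" using 4 by auto
      then show ?thesis using c2 4 a b V sing irr by (auto simp: sal_def alex_def)
    next
      case c3: 3
      then have "{a1, a2} - {b1, b2} = {a1}" "{b1, b2} - {a1, a2} = {b1}" using 4 by auto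
      then show ?thesis using c3 4 a b V sing irr by (auto simp: sal_def alex_def)
    next
      case c4: 4
      have n: "b1 \<noteq> a2" using c4 l tr irr by blast
      then have e: "{a1, a2} - {b1, b2} = {a2}" "{b1, b2} - {a1, a2} = {b1}" using 4 c4 by auto
      have "(b2, a2) \<in> ?r" "(b1, a2) \<in> ?r" using l c4 tr by auto
      then have "(a2, b1) \<notin> ?r" "(a2, b2) \<notin> ?r" using tr irr by blast+
      then show ?thesis using e c4 n 4 a b V sing irr by (auto simp: sal_def alex_def)
    next
      case c5: 5
      have n: "a1 \<noteq> b2" using c5 l tr irr by blast
      then have e: "{a1, a2} - {b1, b2} = {a1}" "{b1, b2} - {a1, a2} = {b2}" using 4 c5 by auto
      have "(a2, b2) \<in> ?r" "(a1, b2) \<in> ?r" using l c5 tr by auto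
      then show ?thesis using e c5 n 4 a b V sing irr by (auto simp: sal_def alex_def)
    next
      case c6: 6
      then have e: "{a1, a2} - {b1, b2} = {a1, a2}" "{b1, b2} - {a1, a2} = {b1, b2}"
        using 4 by auto
      then show ?thesis using c6 4 a b V pair l by (auto simp: sal_def alex_def)
    qed
  qed (use a b in \<open>auto simp: sal_def\<close>)
qed

lemma strict_chain_sal:
  assumes A: "reflexive_digraph_linext A"
  shows "strict_chain (arcs A) (sal A)"
proof -
  let ?r = "lin A"
  have c: "strict_chain (verts A) ?r" and sub: "arcs A \<subseteq> verts A \<times> verts A"
    using A unfolding reflexive_digraph_linext_def by auto
  have tr: "\<And>x y z. (x, y) \<in> ?r \<Longrightarrow> (y, z) \<in> ?r \<Longrightarrow> (x, z) \<in> ?r" and irr: "\<And>x. (x, x) \<notin> ?r"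
    and tot: "\<And>x y. x \<in> verts A \<Longrightarrow> y \<in> verts A \<Longrightarrow> x \<noteq> y \<Longrightarrow> (x, y) \<in> ?r \<or> (y, x) \<in> ?r"
    using c unfolding strict_chain_def strict_linear_order_on_def trans_def irrefl_def total_on_def
    by blast+
  have s: "sal A \<subseteq> arcs A \<times> arcs A" by (auto simp: sal_def)
  have "trans (sal A)"
  proof (rule transI)
    fix p q t assume h: "(p, q) \<in> sal A" "(q, t) \<in> sal A"
    obtain p1 p2 q1 q2 t1 t2 where e: "p = (p1, p2)" "q = (q1, q2)" "t = (t1, t2)"
      by (cases p, cases q, cases t) auto
    have a: "(p1, p2) \<in> arcs A" "(q1, q2) \<in> arcs A" "(t1, t2) \<in> arcs A"
      using h s e by auto
    show "(p, t) \<in> sal A"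
      using h tr[of p1 q1 t1] tr[of p2 q2 t2]
      unfolding e sal_iff[OF A a(1,2)] sal_iff[OF A a(2,3)] sal_iff[OF A a(1,3)] by metis
  qed
  moreover have "irrefl (sal A)"
    unfolding irrefl_def
  proof safe
    fix x y assume h: "((x, y), (x, y)) \<in> sal A"
    then have "(x, y) \<in> arcs A" using s by auto
    then show False using h irr by (simp add: sal_iff[OF A])
  qed
  moreover have "total_on (arcs A) (sal A)"
    unfolding total_on_def
  proof (intro ballI impI)
    fix p q assume h: "p \<in> arcs A" "q \<in> arcs A" "p \<noteq> q"
    obtain p1 p2 q1 q2 where e: "p = (p1, p2)" "q = (q1, q2)" by (cases p, cases q) auto
    have a: "(p1, p2) \<in> arcs A" "(q1, q2) \<in> arcs A" using h e by auto
    then have "p1 \<in> verts A" "p2 \<in> verts A" "q1 \<in> verts A" "q2 \<in> verts A" using sub by auto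
    then show "(p, q) \<in> sal A \<or> (q, p) \<in> sal A"
      using h(3) tot[of p1 q1] tot[of p2 q2]
      unfolding e sal_iff[OF A a(1,2)] sal_iff[OF A a(2,1)] by auto
  qed
  ultimately show ?thesis using s unfolding strict_chain_def strict_linear_order_on_def by blast
qed

lemma rigid_surjection_id:
  assumes "strict_chain X r"
  shows "rigid_surjection X r X r (\<lambda>x. x)"
proof -
  have "chain_min r {u \<in> X. u = x} = x" if "x \<in> X" for x
    by (rule chain_min_eqI[OF assms]) (use that in auto)
  then show ?thesis unfolding rigid_surjection_def by auto
qed

lemma rigid_surjection_cong:
  assumes "\<And>x. x \<in> X \<Longrightarrow> f x = g x"
  shows "rigid_surjection X r Y s f \<longleftrightarrow> rigid_surjection X r Y s g"
proof -
  have "{u \<in> X. f u = x} = {u \<in> X. g u = x}" for x using assms by auto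
  moreover have "f ` X = g ` X" using assms by auto
  ultimately show ?thesis unfolding rigid_surjection_def by simp
qed

lemma rigid_surjection_comp:
  assumes X: "strict_chain X r" "finite X" and Y: "strict_chain Y s" "finite Y"
    and f: "rigid_surjection X r Y s f" and g: "rigid_surjection Y s Z t g"
  shows "rigid_surjection X r Z t (g \<circ> f)"
proof -
  have fX: "f ` X = Y" and gY: "g ` Y = Z" using f g unfolding rigid_surjection_def by auto
  have trr: "\<And>x y z. (x, y) \<in> r \<Longrightarrow> (y, z) \<in> r \<Longrightarrow> (x, z) \<in> r"
    using X unfolding strict_chain_def strict_linear_order_on_def trans_def by blast
  have key: "chain_min r {u \<in> X. (g \<circ> f) u = z} = chain_min r {u \<in> X. f u = chain_min s {v \<in> Y. g v = z}}"
    if "z \<in> Z" for z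
  proof -
    let ?y = "chain_min s {v \<in> Y. g v = z}"
    let ?x = "\<lambda>y. chain_min r {u \<in> X. f u = y}"
    have y: "?y \<in> {v \<in> Y. g v = z}"
      "\<And>v. v \<in> {v \<in> Y. g v = z} \<Longrightarrow> v \<noteq> ?y \<Longrightarrow> (?y, v) \<in> s"
      by (rule chain_min_props[OF Y(1)]; use that gY Y in auto)+
    have x: "?x y \<in> {u \<in> X. f u = y}"
      "\<And>u. u \<in> {u \<in> X. f u = y} \<Longrightarrow> u \<noteq> ?x y \<Longrightarrow> (?x y, u) \<in> r" if "y \<in> Y" for y
      by (rule chain_min_props[OF X(1)]; use that fX X in auto)+
    show ?thesis
    proof (rule chain_min_eqI[OF X(1)])
      show "?x ?y \<in> {u \<in> X. (g \<circ> f) u = z}" using x(1)[of ?y] y(1) by auto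
    next
      fix u assume u: "u \<in> {u \<in> X. (g \<circ> f) u = z}" "u \<noteq> ?x ?y"
      have fu: "f u \<in> Y" "g (f u) = z" using u fX by auto
      show "(?x ?y, u) \<in> r"
      proof (cases "f u = ?y")
        case True then show ?thesis using x(2)[of ?y u] u y(1) by auto
      next
        case False
        then have "(?y, f u) \<in> s" using y(2) fu by auto
        then have m: "(?x ?y, ?x (f u)) \<in> r"
          using f fu y(1) unfolding rigid_surjection_def by auto
        show ?thesis
        proof (cases "?x (f u) = u")
          case True then show ?thesis using m by (rule subst)
        next
          case False
          then have "(?x (f u), u) \<in> r" by (intro x(2)[OF fu(1)]) (use u(1) in simp_all)
          then show ?thesis by (rule trr[OF m])
        qed
      qed
    qed
  qed
  show ?thesis
    unfolding rigid_surjection_def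
  proof (intro conjI ballI impI)
    show "(g \<circ> f) ` X = Z" using fX gY by auto
    fix a b assume ab: "a \<in> Z" "b \<in> Z" "(a, b) \<in> t"
    have "chain_min s {v \<in> Y. g v = a} \<in> {v \<in> Y. g v = a}"
      "chain_min s {v \<in> Y. g v = b} \<in> {v \<in> Y. g v = b}"
      by (rule chain_min_props[OF Y(1)]; use ab gY Y in auto)+
    moreover have "(chain_min s {v \<in> Y. g v = a}, chain_min s {v \<in> Y. g v = b}) \<in> s"
      using g ab unfolding rigid_surjection_def by auto
    ultimately show "(chain_min r {u \<in> X. (g \<circ> f) u = a}, chain_min r {u \<in> X. (g \<circ> f) u = b}) \<in> r"
      unfolding key[OF ab(1)] key[OF ab(2)] using f unfolding rigid_surjection_def by auto
  qed
qed

lemma finite_arcs: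
  "finite (verts A) \<Longrightarrow> reflexive_digraph_linext A \<Longrightarrow> finite (arcs A)"
  unfolding reflexive_digraph_linext_def by (meson finite_SigmaI finite_subset)

lemma strong_rigid_quotient_id:
  assumes A: "reflexive_digraph_linext A"
  shows "strong_rigid_quotient A A (restrict (\<lambda>x. x) (verts A))"
proof -
  have sub: "arcs A \<subseteq> verts A \<times> verts A" using A unfolding reflexive_digraph_linext_def by auto
  have "rigid_surjection (arcs A) (sal A) (arcs A) (sal A)
      (\<lambda>(x, y). (restrict (\<lambda>x. x) (verts A) x, restrict (\<lambda>x. x) (verts A) y))
    \<longleftrightarrow> rigid_surjection (arcs A) (sal A) (arcs A) (sal A) (\<lambda>x. x)"
    by (rule rigid_surjection_cong) (use sub in auto)
  then show ?thesis using rigid_surjection_id[OF strict_chain_sal[OF A]] sub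
    unfolding strong_rigid_quotient_def by auto
qed

lemma strong_rigid_quotient_compose:
  assumes A: "finite (verts A)" "reflexive_digraph_linext A"
    and B: "finite (verts B)" "reflexive_digraph_linext B"
    and f: "strong_rigid_quotient A B f" and g: "strong_rigid_quotient B C g"
  shows "strong_rigid_quotient A C (compose (verts A) g f)"
proof -
  have sub: "arcs A \<subseteq> verts A \<times> verts A"
    using A unfolding reflexive_digraph_linext_def by auto
  have "rigid_surjection (arcs A) (sal A) (arcs C) (sal C)
      ((\<lambda>(x, y). (g x, g y)) \<circ> (\<lambda>(x, y). (f x, f y)))"
    by (rule rigid_surjection_comp[OF strict_chain_sal[OF A(2)] finite_arcs[OF A]
          strict_chain_sal[OF B(2)] finite_arcs[OF B]])
      (use f g in \<open>auto simp: strong_rigid_quotient_def\<close>)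
  also have "?this \<longleftrightarrow> rigid_surjection (arcs A) (sal A) (arcs C) (sal C)
      (\<lambda>(x, y). (compose (verts A) g f x, compose (verts A) g f y))"
    by (rule rigid_surjection_cong) (use sub in \<open>auto simp: compose_def\<close>)
  finally have r: "rigid_surjection (arcs A) (sal A) (arcs C) (sal C)
      (\<lambda>(x, y). (compose (verts A) g f x, compose (verts A) g f y))" .
  have h: "\<forall>x y. (x, y) \<in> arcs A \<longrightarrow>
      (compose (verts A) g f x, compose (verts A) g f y) \<in> arcs C"
    using f g sub unfolding strong_rigid_quotient_def by (fastforce simp: compose_def)
  have m: "compose (verts A) g f \<in> verts A \<rightarrow>\<^sub>E verts C"
    using f g unfolding strong_rigid_quotient_def by (auto simp: compose_def PiE_iff)
  show ?thesis unfolding strong_rigid_quotient_def using m h r by blast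
qed

lemma category_srq:
  assumes obs: "\<And>A. A \<in> Obs \<Longrightarrow> finite (verts A) \<and> reflexive_digraph_linext A"
  shows "category \<lparr>Ob = Obs, Hom = (\<lambda>A B. {f. strong_rigid_quotient A B f}),
    Comp = (\<lambda>A B C g f. compose (verts A) g f)\<rparr>"
proof (unfold_locales, goal_cases)
  case (1 X Y Z f g)
  then show ?case using obs[of X] obs[of Y] strong_rigid_quotient_compose[of X Y f Z g] by simp
next
  case (2 W X Y Z f g h)
  then have "f \<in> verts W \<rightarrow>\<^sub>E verts X" by (simp add: strong_rigid_quotient_def)
  then show ?case by (auto simp: compose_def restrict_def PiE_iff)
next
  case (3 X)
  have "strong_rigid_quotient X X (restrict (\<lambda>x. x) (verts X))"
    using strong_rigid_quotient_id[of X] obs[of X] 3 by simp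
  moreover have "compose (verts X) f (restrict (\<lambda>x. x) (verts X)) = f"
    if "strong_rigid_quotient X Y f" for Y f
    using that unfolding strong_rigid_quotient_def
    by (auto simp: compose_def restrict_def PiE_iff extensional_def)
  moreover have "compose (verts Y) (restrict (\<lambda>x. x) (verts X)) f = f"
    if "strong_rigid_quotient Y X f" for Y f
    using that unfolding strong_rigid_quotient_def
    by (auto simp: compose_def restrict_def PiE_iff extensional_def)
  ultimately show ?case by (intro bexI[of _ "restrict (\<lambda>x. x) (verts X)"]) auto
qed

lemma category_EDig_srq: "category EDig_srq"
  unfolding EDig_srq_def by (rule category_srq) auto

lemma category_EPos_srq: "category EPos_srq"
  unfolding EPos_srq_def by (rule category_srq) (auto simp: poset_linext_def)

end

theory Submission
  imports Defs "HOL-Library.Countable"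
begin

text \<open>Only the arcs of the objects matter. Given a word of arcs of \<open>B\<close>, in which the first occurrences of
  the arcs are ordered by \<open>sal B\<close>, the disjoint union of as many arcs as there are letters maps onto \<open>B\<close>
  by sending the \<open>i\<close>-th arc to the \<open>i\<close>-th letter. This is a strong rigid quotient map: loops come first
  in \<open>sal B\<close>, so a loop at a vertex occurs in the word before any other arc at that vertex. The
  construction commutes with composition, and a disjoint union of arcs is a poset, so both claims
  follow from the dual Ramsey theorem for rigid surjections, the Graham-Rothschild theorem over the
  empty alphabet.

  That theorem is proved by induction on the number of parameters, simultaneously for all alphabets.
  Write a word as \<open>g x\<^sub>0 h\<close> with \<open>g\<close> over the alphabet; \<open>h\<close> has one parameter less over an alphabet with
  one more letter \<open>x\<^sub>0\<close>. The induction hypothesis makes the colour independent of \<open>h\<close>, the Hales-Jewett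
  theorem makes it depend only on the length of \<open>g\<close>, and the pigeonhole principle fixes it.\<close>

subsection \<open>Parameter words\<close>

text \<open>\<open>pword t m w\<close>: the word \<open>w\<close> has letters below \<open>t\<close> and parameters \<open>t, \<dots>, m - 1\<close>, which all occur and
  whose first occurrences are in increasing order. Prefixing \<open>0, \<dots>, t - 1\<close> turns it into a rigid
  surjection onto \<open>m\<close> that is the identity on \<open>t\<close>.\<close>

fun pword :: "nat \<Rightarrow> nat \<Rightarrow> nat list \<Rightarrow> bool" where
  "pword t m [] \<longleftrightarrow> t = m"
| "pword t m (a # w) \<longleftrightarrow> a < t \<and> pword t m w \<or> a = t \<and> pword (Suc t) m w"

definition pwords :: "nat \<Rightarrow> nat \<Rightarrow> nat \<Rightarrow> nat list set" where
  "pwords t m n = {w. pword t m w \<and> length w = n}"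

text \<open>Composition of rigid surjections that fix the letters below \<open>t\<close>;
  \<open>f\<close> lists the values of the parameters alone, hence the shift by
  \<open>t\<close>.\<close>

definition subst :: "nat \<Rightarrow> nat list \<Rightarrow> nat list \<Rightarrow> nat list" where
  "subst t f w = map (\<lambda>i. if i < t then i else f ! (i - t)) w"

lemma pword_le: "pword t m w \<Longrightarrow> t \<le> m"
  by (induction w arbitrary: t) (auto dest: Suc_leD)

lemma pword_less: "pword t m w \<Longrightarrow> x \<in> set w \<Longrightarrow> x < m"
  by (induction w arbitrary: t) (auto dest: pword_le)

lemma pword_append: "pword t m u \<Longrightarrow> pword m k v \<Longrightarrow> pword t k (u @ v)"
  by (induction u arbitrary: t) auto

lemma pword_letters: "set u \<subseteq> {..<t} \<Longrightarrow> pword t m (u @ v) \<longleftrightarrow> pword t m v"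
  by (induction u) auto

lemma pword_same: "pword t t w \<longleftrightarrow> set w \<subseteq> {..<t}"
  by (induction w) (auto dest: pword_le)

lemma pword_upt: "t \<le> m \<Longrightarrow> pword t m [t..<m]"
proof (induction "m - t" arbitrary: t)
  case (Suc d)
  then have "[t..<m] = t # [Suc t..<m]" by (simp add: upt_conv_Cons)
  then show ?case using Suc by simp
qed simp

text \<open>The first occurrences in \<open>w\<close> run through \<open>t, ..., m - 1\<close> in
  order, so new values appear in \<open>map s w\<close> in the same order as in
  \<open>map s [t..<m]\<close>; a repeated letter only repeats a value seen before. This serves
  substitution as well as renaming of parameters.\<close>

lemma pword_map:
  assumes "pword t m w" "s ` {..<t} \<subseteq> {..<t'}" "pword t' k (map s [t..<m])"
  shows "pword t' k (map s w)"
  using assms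
proof (induction w arbitrary: t t')
  case (Cons a w)
  show ?case
  proof (cases "a < t")
    case True
    then show ?thesis using Cons.IH[of t t'] Cons.prems by auto
  next
    case False
    then have a: "a = t" and w: "pword (Suc t) m w" using Cons.prems(1) by auto
    then have "[t..<m] = t # [Suc t..<m]" using pword_le[OF w] by (simp add: upt_conv_Cons)
    then consider "s t < t'" "pword t' k (map s [Suc t..<m])"
      | "s t = t'" "pword (Suc t') k (map s [Suc t..<m])"
      using Cons.prems(3) by auto
    then show ?thesis
    proof cases
      case 1
      then show ?thesis using Cons.IH[OF w, of t'] Cons.prems(2) a by (auto simp: lessThan_Suc)
    next
      case 2
      then show ?thesis using Cons.IH[OF w, of "Suc t'"] Cons.prems(2) a
        by (auto simp: lessThan_Suc image_subset_iff less_Suc_eq)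
    qed
  qed
qed simp

text \<open>Cut at the first occurrence of \<open>q\<close>: no larger parameter can have occurred
  before it, and what follows may use \<open>q\<close> as a letter.\<close>

lemma pword_split:
  assumes "pword t m w" "t \<le> q" "q < m"
  shows "\<exists>u z. w = u @ q # z \<and> set u \<subseteq> {..<q} \<and> pword (Suc q) m z"
  using assms
proof (induction w arbitrary: t)
  case (Cons a w)
  consider "a < t" "pword t m w" | "a = t" "t < q" "pword (Suc t) m w"
    | "a = q" "pword (Suc q) m w" using Cons.prems by (cases "t = q") auto
  then show ?case
  proof cases
    case 1
    then obtain u z where "w = u @ q # z" "set u \<subseteq> {..<q}" "pword (Suc q) m z"
      using Cons.IH[of t] Cons.prems by auto
    then have "a # w = (a # u) @ q # z \<and> set (a # u) \<subseteq> {..<q} \<and> pword (Suc q) m z"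
      using 1 Cons.prems by auto
    then show ?thesis by blast
  next
    case 2
    then obtain u z where "w = u @ q # z" "set u \<subseteq> {..<q}" "pword (Suc q) m z"
      using Cons.IH[of "Suc t"] Cons.prems by auto
    then have "a # w = (a # u) @ q # z \<and> set (a # u) \<subseteq> {..<q} \<and> pword (Suc q) m z"
      using 2 by auto
    then show ?thesis by blast
  next
    case 3
    then show ?thesis by (intro exI[of _ "[]"] exI[of _ w]) auto
  qed
qed simp

text \<open>A criterion by positions instead of recursion. In this form the condition is read off
  from a rigid surjection.\<close>

lemma pwordI:
  assumes "{..<t} \<union> set w = {..<m}"
    and "\<And>i y. i < length w \<Longrightarrow> y < w ! i \<Longrightarrow> y < t \<or> (\<exists>j<i. w ! j = y)"
  shows "pword t m w"
  using assms
proof (induction w arbitrary: t)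
  case Nil
  then show ?case by (simp add: lessThan_eq_iff)
next
  case (Cons a w)
  \<comment> \<open>Nothing precedes position 0, so a first letter above \<open>t\<close> would
    leave \<open>t\<close> without an earlier occurrence.\<close>
  have a: "a \<le> t" using Cons.prems(2)[of 0 t] by (cases "t < a") auto
  have *: "y < t \<or> y = a \<or> (\<exists>j<i. w ! j = y)" if "i < length w" "y < w ! i" for i y
  proof -
    have "y < t \<or> (\<exists>j<Suc i. (a # w) ! j = y)" using Cons.prems(2)[of "Suc i" y] that by simp
    then show ?thesis by (auto simp: less_Suc_eq_0_disj)
  qed
  show ?case
  proof (cases "a = t")
    case True
    have "pword (Suc t) m w"
    proof (rule Cons.IH)
      show "{..<Suc t} \<union> set w = {..<m}" using Cons.prems(1) True by (simp add: lessThan_Suc)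
    next
      fix i y assume "i < length w" "y < w ! i"
      then show "y < Suc t \<or> (\<exists>j<i. w ! j = y)" using *[of i y] True by auto
    qed
    then show ?thesis using True by simp
  next
    case False
    then have "a < t" using a by simp
    moreover have "pword t m w"
    proof (rule Cons.IH)
      show "{..<t} \<union> set w = {..<m}" using Cons.prems(1) \<open>a < t\<close> by (simp add: insert_absorb)
    next
      fix i y assume "i < length w" "y < w ! i"
      then show "y < t \<or> (\<exists>j<i. w ! j = y)" using *[of i y] \<open>a < t\<close> by auto
    qed
    ultimately show ?thesis by simp
  qed
qed

lemma pwords_less: "w \<in> pwords t m n \<Longrightarrow> x \<in> set w \<Longrightarrow> x < m"
  by (auto simp: pwords_def dest: pword_less)

lemma pwords_same: "pwords t t n = {w. set w \<subseteq> {..<t} \<and> length w = n}"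
  by (simp add: pwords_def pword_same)

lemma finite_pwords_same: "finite (pwords t t n)"
  by (simp add: pwords_same finite_lists_length_eq)

lemma pwords_upt: "t \<le> m \<Longrightarrow> [t..<m] \<in> pwords t m (m - t)"
  by (simp add: pwords_def pword_upt)

section \<open>Substitution as composition of parameter words\<close>

lemma length_subst [simp]: "length (subst t f w) = length w"
  by (simp add: subst_def)

lemma subst_append: "subst t f (u @ v) = subst t f u @ subst t f v"
  by (simp add: subst_def)

lemma subst_pwords:
  assumes w: "w \<in> pwords t (t + m) n" and f: "f \<in> pwords t k m"
  shows "subst t f w \<in> pwords t k n"
proof -
  have m: "map (\<lambda>i. if i < t then i else f ! (i - t)) [t..<t + m] = f"
    using f by (intro nth_equalityI) (auto simp: pwords_def)
  have "pword t k (subst t f w)" unfolding subst_def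
    by (rule pword_map[of t "t + m"]) (use w f m in \<open>auto simp: pwords_def\<close>)
  then show ?thesis using w by (simp add: pwords_def)
qed

text \<open>Associativity of composition. The bound on the letters of \<open>w\<close> keeps every
  lookup in \<open>v\<close> within its length.\<close>

lemma subst_subst:
  assumes "w \<in> pwords t (t + length v) n"
  shows "subst t f (subst t v w) = subst t (subst t f v) w"
  using pwords_less[OF assms] by (fastforce simp: subst_def nth_map)

lemma subst_upt: "subst t f [t..<t + length f] = f"
  by (rule nth_equalityI) (auto simp: subst_def)

lemma subst_append_param:
  assumes "set w \<subseteq> {..<t + length f}"
  shows "subst t (f @ g) w = subst t f w"
  unfolding subst_def by (rule map_cong) (use assms in \<open>auto simp: nth_append\<close>)

subsection \<open>The Hales-Jewett theorem\<close>

text \<open>A vector of colours is encoded as a single colour.\<close>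

definition vec :: "('a \<Rightarrow> nat) \<Rightarrow> 'a list \<Rightarrow> nat" where
  "vec h xs = to_nat (map h xs)"

definition vecs :: "nat set \<Rightarrow> nat \<Rightarrow> nat set" where
  "vecs S n = to_nat ` {l :: nat list. set l \<subseteq> S \<and> length l = n}"

lemma finite_vecs: "finite S \<Longrightarrow> finite (vecs S n)"
  by (simp add: vecs_def finite_lists_length_eq)

lemma vec_in_vecs: "(\<And>x. x \<in> set xs \<Longrightarrow> h x \<in> S) \<Longrightarrow> vec h xs \<in> vecs S (length xs)"
  unfolding vec_def vecs_def by (rule imageI) auto

lemma vec_eqD: "vec h xs = vec h' xs \<Longrightarrow> x \<in> set xs \<Longrightarrow> h x = h' x"
  by (simp add: vec_def)

text \<open>Here \<open>k\<close> counts letters and parameters together, whereas \<open>m\<close>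
  counts parameters only. Colours form any finite set of naturals, so that codes of colour vectors
  are colours again. For \<open>t = k\<close> this is the Hales-Jewett theorem: \<open>f\<close> is
  a plain word and \<open>w\<close> a combinatorial subspace.\<close>

definition graham_rothschild :: "nat \<Rightarrow> nat \<Rightarrow> bool" where
  "graham_rothschild t k \<longleftrightarrow> (\<forall>m (S :: nat set). finite S \<longrightarrow>
    (\<exists>n. \<forall>\<chi> \<in> pwords t k n \<rightarrow> S. \<exists>w \<in> pwords t (t + m) n. \<exists>c.
      \<forall>f \<in> pwords t k m. \<chi> (subst t f w) = c))"

lemma graham_rothschildD:
  fixes S :: "nat set"
  assumes "graham_rothschild t k" "finite S"
  shows "\<exists>n. \<forall>\<chi> \<in> pwords t k n \<rightarrow> S. \<exists>w \<in> pwords t (t + m) n. \<exists>c.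
    \<forall>f \<in> pwords t k m. \<chi> (subst t f w) = c"
  using assms unfolding graham_rothschild_def by simp

text \<open>Shelah's lemma: among the words \<open>p\<^sup>a (p+1)\<^sup>N\<^sup>-\<^sup>a\<close> two must look alike in every context, so a parameter
  put where they differ cannot distinguish the letters \<open>p\<close> and \<open>p + 1\<close>.\<close>

lemma shelah_insensitive:
  fixes p :: nat and S :: "nat set"
  defines "T \<equiv> Suc (Suc p)"
  assumes "finite S"
  shows "\<exists>n. \<forall>\<chi> \<in> pwords T T n \<rightarrow> S. \<exists>w \<in> pwords T (T + m) n.
    \<forall>f \<in> pwords T T m. \<forall>f' \<in> pwords T T m. map (min p) f = map (min p) f' \<longrightarrow>
      \<chi> (subst T f w) = \<chi> (subst T f' w)"
  using \<open>finite S\<close>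
proof (induction m arbitrary: S)
  case 0
  show ?case by (intro exI[of _ 0]) (auto simp: pwords_def)
next
  case (Suc m)
  obtain n' where n': "\<forall>\<chi> \<in> pwords T T n' \<rightarrow> vecs S T. \<exists>w \<in> pwords T (T + m) n'.
    \<forall>f \<in> pwords T T m. \<forall>f' \<in> pwords T T m. map (min p) f = map (min p) f' \<longrightarrow>
      \<chi> (subst T f w) = \<chi> (subst T f' w)"
    using Suc.IH[OF finite_vecs[OF Suc.prems]] ..
  \<comment> \<open>The length \<open>n'\<close> is fixed first, because the appended blocks are
    compared behind every word of length \<open>n'\<close>; \<open>ys\<close> lists these
    words.\<close>
  obtain ys where ys: "set ys = pwords T T n'" using finite_list[OF finite_pwords_same] by blast
  \<comment> \<open>This is the number of colour vectors indexed by \<open>ys\<close>, so among the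
    \<open>N + 1\<close> words \<open>s a\<close> with \<open>a \<le> N\<close> two have the same
    vector.\<close>
  define N where "N = card (vecs S (length ys))"
  show ?case
  proof (intro exI[of _ "n' + N"] ballI)
    fix \<chi> assume \<chi>: "\<chi> \<in> pwords T T (n' + N) \<rightarrow> S"
    define s where "s a = replicate a p @ replicate (N - a) (Suc p)" for a
    have \<chi>S: "\<chi> (y @ z) \<in> S" if "y \<in> pwords T T n'" "set z \<subseteq> {..<T}" "length z = N" for y z
      using \<chi> that by (intro funcset_mem[OF \<chi>]) (auto simp: pwords_same)
    have "(\<lambda>a. vec (\<lambda>y. \<chi> (y @ s a)) ys) ` {..N} \<subseteq> vecs S (length ys)"
      by (auto intro!: vec_in_vecs \<chi>S simp: ys s_def T_def)
    then have "card ((\<lambda>a. vec (\<lambda>y. \<chi> (y @ s a)) ys) ` {..N}) \<le> N"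
      unfolding N_def by (rule card_mono[OF finite_vecs[OF Suc.prems]])
    then have "card ((\<lambda>a. vec (\<lambda>y. \<chi> (y @ s a)) ys) ` {..N}) < card {..N}" by simp
    then have "\<not> inj_on (\<lambda>a. vec (\<lambda>y. \<chi> (y @ s a)) ys) {..N}" by (rule pigeonhole)
    then obtain a b where ab: "a < b" "b \<le> N"
      and eq: "vec (\<lambda>y. \<chi> (y @ s a)) ys = vec (\<lambda>y. \<chi> (y @ s b)) ys"
      unfolding inj_on_def by (metis atMost_iff linorder_neqE_nat)
    \<comment> \<open>The stretch between \<open>a\<close> and \<open>b\<close> becomes the new
      parameter: the value \<open>p\<close> gives back \<open>s b\<close>, the value
      \<open>p + 1\<close> gives back \<open>s a\<close>.\<close>
    define B where "B c = replicate a p @ replicate (b - a) c @ replicate (N - b) (Suc p)" for c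
    have B: "B p = s b" "B (Suc p) = s a" "length (B c) = N" for c
      using ab by (auto simp: B_def s_def simp flip: replicate_add append_assoc)
    obtain w where w: "w \<in> pwords T (T + m) n'" and ww: "\<And>f f'. f \<in> pwords T T m \<Longrightarrow>
        f' \<in> pwords T T m \<Longrightarrow> map (min p) f = map (min p) f' \<Longrightarrow>
        vec (\<lambda>c. \<chi> (subst T f w @ B c)) [0..<T] = vec (\<lambda>c. \<chi> (subst T f' w @ B c)) [0..<T]"
    proof -
      \<comment> \<open>Colouring \<open>y\<close> by the vector of colours of all its continuations
        \<open>B c\<close> makes the first \<open>m\<close> parameters insensitive whatever the
        value of the last one is.\<close>
      have "(\<lambda>y. vec (\<lambda>c. \<chi> (y @ B c)) [0..<T]) \<in> pwords T T n' \<rightarrow> vecs S T"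
      proof
        fix y assume "y \<in> pwords T T n'"
        then have "vec (\<lambda>c. \<chi> (y @ B c)) [0..<T] \<in> vecs S (length [0..<T])"
          by (intro vec_in_vecs \<chi>S B) (auto simp: B_def T_def)
        then show "vec (\<lambda>c. \<chi> (y @ B c)) [0..<T] \<in> vecs S T" by simp
      qed
      from bspec[OF n' this] show ?thesis using that by blast
    qed
    have 1: "pword (T + m) (Suc (T + m)) (B (T + m))"
    proof -
      \<comment> \<open>As \<open>a < b\<close>, the stretch is not empty and the new parameter does
        occur.\<close>
      obtain d where d: "b - a = Suc d" using ab by (metis Suc_diff_Suc)
      have "set (replicate (N - b) (Suc p)) \<subseteq> {..<Suc (T + m)}" "set (replicate a p) \<subseteq> {..<T + m}"
        "set (replicate d (T + m)) \<subseteq> {..<Suc (T + m)}"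
        by (auto simp: T_def)
      then show ?thesis by (simp add: B_def d pword_letters pword_same)
    qed
    show "\<exists>w \<in> pwords T (T + Suc m) (n' + N). \<forall>f \<in> pwords T T (Suc m). \<forall>f' \<in> pwords T T (Suc m).
        map (min p) f = map (min p) f' \<longrightarrow> \<chi> (subst T f w) = \<chi> (subst T f' w)"
    proof (intro bexI ballI impI)
      show "w @ B (T + m) \<in> pwords T (T + Suc m) (n' + N)"
        using w B 1 by (auto simp: pwords_def intro: pword_append)
      fix f f' assume f: "f \<in> pwords T T (Suc m)" "f' \<in> pwords T T (Suc m)"
        and e: "map (min p) f = map (min p) f'"
      obtain g c where g: "f = g @ [c]" using f(1) by (cases f rule: rev_cases) (auto simp: pwords_def)
      obtain g' c' where g': "f' = g' @ [c']" using f(2) by (cases f' rule: rev_cases) (auto simp: pwords_def)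
      have gg: "g \<in> pwords T T m" "g' \<in> pwords T T m" "c < T" "c' < T"
        using f by (auto simp: g g' pwords_same)
      have s: "subst T (h @ [x]) (w @ B (T + m)) = subst T h w @ B x" if "h \<in> pwords T T m" for h x
      proof -
        have "subst T (h @ [x]) w = subst T h w"
          using pwords_less[OF w] that by (intro subst_append_param) (auto simp: pwords_def)
        moreover have "subst T (h @ [x]) (B (T + m)) = B x"
          using that by (auto simp: B_def subst_def T_def pwords_def)
        ultimately show ?thesis by (simp add: subst_append)
      qed
      \<comment> \<open>First exchange \<open>g\<close> for \<open>g'\<close> with the last value
        kept, then exchange the last value: distinct \<open>c\<close> and \<open>c'\<close> with
        equal \<open>min p\<close> are \<open>p\<close> and \<open>p + 1\<close>.\<close>
      have "\<chi> (subst T g w @ B c) = \<chi> (subst T g' w @ B c)"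
        using ww[OF gg(1,2)] e gg(3) vec_eqD by (fastforce simp: g g')
      moreover have "\<chi> (subst T g' w @ B c) = \<chi> (subst T g' w @ B c')"
      proof -
        have "subst T g' w \<in> set ys" using subst_pwords[OF w gg(2)] ys by simp
        then have "\<chi> (subst T g' w @ B p) = \<chi> (subst T g' w @ B (Suc p))"
          using vec_eqD[OF eq] by (simp add: B)
        moreover have "c = c' \<or> c = p \<and> c' = Suc p \<or> c' = p \<and> c = Suc p"
          using e gg by (auto simp: g g' T_def min_def less_Suc_eq split: if_splits)
        ultimately show ?thesis by auto
      qed
      ultimately show "\<chi> (subst T f (w @ B (T + m))) = \<chi> (subst T f' (w @ B (T + m)))"
        by (simp add: s g g' gg)
    qed
  qed
qed

text \<open>Induction on the alphabet. Insensitivity to exchanging the two largest letters allows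
  merging them by \<open>min p\<close>, so a monochromatic subspace over one letter less suffices.
  Over at most one letter there is at most one word of each length.\<close>

lemma hales_jewett: "graham_rothschild t t"
proof -
  have unique: "graham_rothschild t t"
    if "\<And>m f g. f \<in> pwords t t m \<Longrightarrow> g \<in> pwords t t m \<Longrightarrow> f = g" for t
    unfolding graham_rothschild_def
  proof (intro allI impI)
    fix m and S :: "nat set"
    have "[t..<t + m] \<in> pwords t (t + m) m" using pwords_upt[of t "t + m"] by simp
    then show "\<exists>n. \<forall>\<chi> \<in> pwords t t n \<rightarrow> S. \<exists>w \<in> pwords t (t + m) n. \<exists>c.
      \<forall>f \<in> pwords t t m. \<chi> (subst t f w) = c" using that by blast
  qed
  show ?thesis
  proof (induction t rule: nat_less_induct)
    case (1 t)
    show ?case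
    proof (cases "t < 2")
      case True
      show ?thesis
      proof (rule unique)
        fix m f g assume "f \<in> pwords t t m" "g \<in> pwords t t m"
        then have "length f = m" "length g = m" "\<forall>i<m. f ! i < t" "\<forall>i<m. g ! i < t"
          by (auto simp: pwords_same subset_iff)
        then show "f = g" using True by (intro nth_equalityI) fastforce+
      qed
    next
      case False
      then obtain p where T: "t = Suc (Suc p)" by (metis add_2_eq_Suc le_Suc_ex not_less)
      let ?T = "Suc (Suc p)"
      have IH: "graham_rothschild (Suc p) (Suc p)" using 1 T by simp
      show ?thesis
        unfolding graham_rothschild_def T
      proof (intro allI impI)
        fix m and S :: "nat set" assume S: "finite S"
        obtain n1 where n1: "\<forall>\<chi> \<in> pwords (Suc p) (Suc p) n1 \<rightarrow> S.
            \<exists>w \<in> pwords (Suc p) (Suc p + m) n1. \<exists>c. \<forall>f \<in> pwords (Suc p) (Suc p) m. \<chi> (subst (Suc p) f w) = c"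
          using graham_rothschildD[OF IH S] ..
        \<comment> \<open>The insensitive subspace needs as many parameters as the length
          \<open>n1\<close> required for the smaller alphabet.\<close>
        obtain n where n: "\<forall>\<chi> \<in> pwords ?T ?T n \<rightarrow> S. \<exists>w \<in> pwords ?T (?T + n1) n.
            \<forall>f \<in> pwords ?T ?T n1. \<forall>f' \<in> pwords ?T ?T n1. map (min p) f = map (min p) f' \<longrightarrow>
              \<chi> (subst ?T f w) = \<chi> (subst ?T f' w)"
          using shelah_insensitive[OF S] ..
        show "\<exists>n. \<forall>\<chi> \<in> pwords ?T ?T n \<rightarrow> S. \<exists>w \<in> pwords ?T (?T + m) n. \<exists>c.
            \<forall>f \<in> pwords ?T ?T m. \<chi> (subst ?T f w) = c"
        proof (intro exI[of _ n] ballI)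
          fix \<chi> assume \<chi>: "\<chi> \<in> pwords ?T ?T n \<rightarrow> S"
          obtain w1 where w1: "w1 \<in> pwords ?T (?T + n1) n"
            and ins: "\<And>f f'. f \<in> pwords ?T ?T n1 \<Longrightarrow> f' \<in> pwords ?T ?T n1 \<Longrightarrow>
              map (min p) f = map (min p) f' \<Longrightarrow> \<chi> (subst ?T f w1) = \<chi> (subst ?T f' w1)"
            using bspec[OF n \<chi>] by blast
          have up: "f \<in> pwords ?T ?T l" if "f \<in> pwords (Suc p) (Suc p) l" for f l
            using that by (auto simp: pwords_same)
          have "(\<lambda>f. \<chi> (subst ?T f w1)) \<in> pwords (Suc p) (Suc p) n1 \<rightarrow> S"
            using funcset_mem[OF \<chi>] subst_pwords[OF w1 up] by blast
          from bspec[OF n1 this] obtain w2 c where w2: "w2 \<in> pwords (Suc p) (Suc p + m) n1"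
            and c: "\<And>f. f \<in> pwords (Suc p) (Suc p) m \<Longrightarrow> \<chi> (subst ?T (subst (Suc p) f w2) w1) = c"
            by blast
          \<comment> \<open>Parameters move up by one to make room for the letter
            \<open>p + 1\<close>, which does not occur in \<open>map s w2\<close>.\<close>
          define s where "s i = (if i < Suc p then i else Suc i)" for i
          have "map s [Suc p..<Suc p + m] = [?T..<?T + m]"
            by (rule nth_equalityI) (auto simp: s_def simp del: upt_Suc)
          then have "pword ?T (?T + m) (map s w2)"
            by (intro pword_map[of "Suc p" "Suc p + m" w2 s])
              (use w2 pword_upt[of ?T "?T + m"] in \<open>auto simp: s_def pwords_def\<close>)
          then have w2': "map s w2 \<in> pwords ?T (?T + m) n1" using w2 by (simp add: pwords_def)
          show "\<exists>w \<in> pwords ?T (?T + m) n. \<exists>c. \<forall>f \<in> pwords ?T ?T m. \<chi> (subst ?T f w) = c"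
          proof (intro bexI exI ballI)
            show "subst ?T (map s w2) w1 \<in> pwords ?T (?T + m) n"
              by (rule subst_pwords[OF w1 w2'])
            fix f assume f: "f \<in> pwords ?T ?T m"
            let ?f = "map (min p) f"
            have f': "?f \<in> pwords (Suc p) (Suc p) m" using f by (auto simp: pwords_same)
            \<comment> \<open>Merging letters commutes with substitution. By insensitivity the word
              obtained from \<open>f\<close> then has the colour of the one obtained from
              \<open>?f\<close>, which lies over the smaller alphabet.\<close>
            have "map (min p) (subst ?T f (map s w2)) = map (min p) (subst (Suc p) ?f w2)"
              unfolding subst_def s_def map_map comp_def
            proof (rule map_cong)
              fix i assume "i \<in> set w2"
              then have "i - Suc p < length f" if "\<not> i < Suc p"
                using pwords_less[OF w2] f that by (fastforce simp: pwords_def)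
              then show "min p (if (if i < Suc p then i else Suc i) < ?T
                    then if i < Suc p then i else Suc i
                    else f ! ((if i < Suc p then i else Suc i) - ?T)) =
                  min p (if i < Suc p then i else ?f ! (i - Suc p))" by simp
            qed simp
            moreover have "subst ?T f (map s w2) \<in> pwords ?T ?T n1"
              "subst (Suc p) ?f w2 \<in> pwords ?T ?T n1"
              using subst_pwords[OF w2' f] up[OF subst_pwords[OF w2 f']] by auto
            ultimately have "\<chi> (subst ?T (subst ?T f (map s w2)) w1) = c"
              using ins c[OF f'] by metis
            then show "\<chi> (subst ?T f (subst ?T (map s w2) w1)) = c"
              using subst_subst[of w1 ?T "map s w2" n f] w1 w2 by (simp add: pwords_def)
          qed
        qed
      qed
    qed
  qed
qed

subsection \<open>The Graham-Rothschild theorem\<close>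

lemma pwords_takeWhile:
  assumes "w \<in> pwords t (t + m) n" "j < m"
  obtains z where "w = takeWhile (\<lambda>i. i < t + j) w @ (t + j) # z"
proof -
  obtain u z where "w = u @ (t + j) # z" "set u \<subseteq> {..<t + j}"
    using pword_split[of t "t + m" w "t + j"] assms by (auto simp: pwords_def)
  then have "takeWhile (\<lambda>i. i < t + j) w = u" by (auto simp: takeWhile_append2 subset_iff)
  then show ?thesis using \<open>w = u @ (t + j) # z\<close> that by simp
qed

text \<open>Before the first occurrence of the parameter \<open>t + length g\<close> only values
  from \<open>g\<close> are used, and at that position the value is \<open>x\<close>. So
  \<open>h\<close> influences only what follows.\<close>

lemma subst_split:
  assumes w: "w \<in> pwords t (t + m) n" and f: "length (g @ x # h) = m"
  obtains h' where "subst t (g @ x # h) w =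
    subst t g (takeWhile (\<lambda>i. i < t + length g) w) @ x # h'"
proof -
  let ?u = "takeWhile (\<lambda>i. i < t + length g) w"
  obtain z where z: "w = ?u @ (t + length g) # z"
    using pwords_takeWhile[OF w, of "length g"] f by auto
  have "subst t (g @ x # h) w = subst t (g @ x # h) ?u @ subst t (g @ x # h) ((t + length g) # z)"
    by (subst z) (rule subst_append)
  also have "subst t (g @ x # h) ?u = subst t g ?u"
    by (rule subst_append_param) (auto dest: set_takeWhileD)
  also have "subst t (g @ x # h) ((t + length g) # z) = x # subst t (g @ x # h) z"
    by (simp add: subst_def)
  finally show ?thesis by (rule that)
qed

text \<open>With \<open>j = 0\<close>, filling a prefix with letters yields a word over the
  alphabet; general \<open>j\<close> serves the cutting of composites.\<close>

lemma set_subst_less: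
  assumes "set g \<subseteq> {..<t + j}" "set u \<subseteq> {..<t + length g}"
  shows "set (subst t g u) \<subseteq> {..<t + j}"
proof -
  have "g ! (i - t) < t + j" if "i \<in> set u" "\<not> i < t" for i
  proof -
    have "i - t < length g" using that assms(2) by fastforce
    then show ?thesis using nth_mem assms(1) by blast
  qed
  then show ?thesis by (auto simp: subst_def)
qed

text \<open>The composite first shows \<open>t + j\<close> at the first occurrence in
  \<open>v\<close> of the parameter whose value is the first \<open>t + j\<close> of
  \<open>w\<close>. Earlier parameters of \<open>v\<close> take smaller values, so cutting commutes
  with composition.\<close>

lemma takeWhile_subst:
  assumes v: "v \<in> pwords t (t + l) n" and w: "w \<in> pwords t (t + m) l" and "j < m"
  shows "takeWhile (\<lambda>i. i < t + j) (subst t w v) =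
    subst t (takeWhile (\<lambda>i. i < t + j) w)
      (takeWhile (\<lambda>i. i < t + length (takeWhile (\<lambda>i. i < t + j) w)) v)"
proof -
  define u where "u = takeWhile (\<lambda>i. i < t + j) w"
  obtain z where z: "w = u @ (t + j) # z"
    unfolding u_def using pwords_takeWhile[OF w \<open>j < m\<close>] by blast
  have "length (u @ (t + j) # z) = l" using w z by (simp add: pwords_def)
  from subst_split[OF v this] obtain h' where
    e: "subst t w v = subst t u (takeWhile (\<lambda>i. i < t + length u) v) @ (t + j) # h'"
    unfolding z by blast
  have "set (subst t u (takeWhile (\<lambda>i. i < t + length u) v)) \<subseteq> {..<t + j}"
    by (rule set_subst_less) (auto simp: u_def dest: set_takeWhileD)
  then have "takeWhile (\<lambda>i. i < t + j) (subst t w v) =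
      subst t u (takeWhile (\<lambda>i. i < t + length u) v)"
    unfolding e by (subst takeWhile_append2) auto
  then show ?thesis by (simp add: u_def)
qed

section \<open>Independence of what follows the first parameter\<close>

lemma pwords_decompose:
  assumes "f \<in> pwords t k m" "t < k"
  obtains g h where "f = g @ t # h" "set g \<subseteq> {..<t}" "pword (Suc t) k h"
  using assms pword_split[of t k f t] unfolding pwords_def by auto

lemma pwords_compose:
  assumes "set g \<subseteq> {..<t}"
  shows "g @ t # h \<in> pwords t k m \<longleftrightarrow> h \<in> pwords (Suc t) k (m - Suc (length g)) \<and> length g < m"
  using pword_letters[OF assms] by (auto simp: pwords_def)

text \<open>Induction on the bound \<open>a\<close>. In the step, a word good for prefixes shorter
  than \<open>a\<close> is composed with one that leaves the first \<open>a + 1\<close> parameters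
  alone and, by the hypothesis for the alphabet \<open>t + 1\<close>, removes the dependence on
  \<open>h\<close> for all \<open>g\<close> of length \<open>a\<close> at once.\<close>

lemma prefix_canonical:
  fixes S :: "nat set"
  assumes tk: "t < k" and gr: "graham_rothschild (Suc t) k" and S: "finite S"
  shows "\<exists>n. \<forall>\<chi> \<in> pwords t k n \<rightarrow> S. \<exists>w \<in> pwords t (t + m) n. \<forall>g h h'.
    length g < a \<longrightarrow> set g \<subseteq> {..<t} \<longrightarrow> g @ t # h \<in> pwords t k m \<longrightarrow> g @ t # h' \<in> pwords t k m \<longrightarrow>
      \<chi> (subst t (g @ t # h) w) = \<chi> (subst t (g @ t # h') w)"
proof (induction a arbitrary: m)
  case 0
  show ?case using pwords_upt[of t "t + m"] by auto
next
  case (Suc a)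
  show ?case
  proof (cases "a < m")
    \<comment> \<open>Every admissible \<open>g\<close> is already shorter than
      \<open>a\<close>.\<close>
    case False
    obtain n where n: "\<forall>\<chi> \<in> pwords t k n \<rightarrow> S. \<exists>w \<in> pwords t (t + m) n. \<forall>g h h'.
      length g < a \<longrightarrow> set g \<subseteq> {..<t} \<longrightarrow> g @ t # h \<in> pwords t k m \<longrightarrow> g @ t # h' \<in> pwords t k m \<longrightarrow>
        \<chi> (subst t (g @ t # h) w) = \<chi> (subst t (g @ t # h') w)"
      using Suc.IH ..
    have "length g < a" if "g @ t # h \<in> pwords t k m" for g h
      using that False by (auto simp: pwords_def)
    then show ?thesis using n by (intro exI[of _ n]) meson
  next
    case True
    obtain gs where gs: "set gs = pwords t t a" using finite_list[OF finite_pwords_same] by blast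
    \<comment> \<open>This many positions remain after \<open>g\<close> and the letter
      \<open>t\<close>. The hypothesis is applied to vectors of colours indexed by all
      \<open>g\<close> of length \<open>a\<close>.\<close>
    define q where "q = m - Suc a"
    obtain n' where n': "\<forall>\<chi> \<in> pwords (Suc t) k n' \<rightarrow> vecs S (length gs).
        \<exists>u \<in> pwords (Suc t) (Suc t + q) n'. \<exists>c. \<forall>h \<in> pwords (Suc t) k q. \<chi> (subst (Suc t) h u) = c"
      using graham_rothschildD[OF gr finite_vecs[OF S]] ..
    define M where "M = Suc a + n'"
    obtain n where n: "\<forall>\<chi> \<in> pwords t k n \<rightarrow> S. \<exists>w \<in> pwords t (t + M) n. \<forall>g h h'.
      length g < a \<longrightarrow> set g \<subseteq> {..<t} \<longrightarrow> g @ t # h \<in> pwords t k M \<longrightarrow> g @ t # h' \<in> pwords t k M \<longrightarrow>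
        \<chi> (subst t (g @ t # h) w) = \<chi> (subst t (g @ t # h') w)"
      using Suc.IH ..
    show ?thesis
    proof (intro exI[of _ n] ballI)
      fix \<chi> assume \<chi>: "\<chi> \<in> pwords t k n \<rightarrow> S"
      obtain w where w: "w \<in> pwords t (t + M) n"
        and ww: "\<And>g h h'. length g < a \<Longrightarrow> set g \<subseteq> {..<t} \<Longrightarrow> g @ t # h \<in> pwords t k M \<Longrightarrow>
          g @ t # h' \<in> pwords t k M \<Longrightarrow> \<chi> (subst t (g @ t # h) w) = \<chi> (subst t (g @ t # h') w)"
        using bspec[OF n \<chi>] by blast
      have M: "g @ t # h \<in> pwords t k M" if "g \<in> set gs" "h \<in> pwords (Suc t) k n'" for g h
        using that gs pwords_compose[of g t h k M] by (auto simp: pwords_same M_def)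
      have "(\<lambda>h. vec (\<lambda>g. \<chi> (subst t (g @ t # h) w)) gs) \<in> pwords (Suc t) k n' \<rightarrow> vecs S (length gs)"
        using M funcset_mem[OF \<chi>] subst_pwords[OF w] by (intro funcsetI vec_in_vecs) blast
      from bspec[OF n' this] obtain u c where u: "u \<in> pwords (Suc t) (Suc t + q) n'"
        and uc: "\<And>h. h \<in> pwords (Suc t) k q \<Longrightarrow>
          vec (\<lambda>g. \<chi> (subst t (g @ t # subst (Suc t) h u) w)) gs = c"
        by blast
      \<comment> \<open>The letter \<open>t\<close> of \<open>u\<close> becomes the parameter
        \<open>t + a\<close>, which takes the value \<open>t\<close> when \<open>g\<close> has
        length \<open>a\<close>; the parameters of \<open>u\<close> are renamed accordingly.\<close>
      define s where "s i = (if i < t then i else i + a)" for i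
      define w' where "w' = [t..<Suc (t + a)] @ map s u"
      have w': "w' \<in> pwords t (t + m) M"
      proof -
        have "map s [Suc t..<Suc t + q] = [Suc (t + a)..<t + m]"
          using True by (intro nth_equalityI) (auto simp: s_def q_def simp del: upt_Suc)
        then have "pword (Suc (t + a)) (t + m) (map s u)"
          by (intro pword_map[of "Suc t" "Suc t + q" u s])
            (use u True pword_upt[of "Suc (t + a)" "t + m"] in \<open>auto simp: s_def pwords_def\<close>)
        then show ?thesis using u pword_append[OF pword_upt[of t "Suc (t + a)"]]
          by (auto simp: w'_def pwords_def M_def simp del: upt_Suc)
      qed
      have sw: "subst t (g @ t # h) w' = g @ t # subst (Suc t) h u" if g: "length g = a" for g h
      proof -
        have s: "set [t..<Suc (t + a)] \<subseteq> {..<t + length (g @ [t])}" using g by auto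
        have "subst t (g @ t # h) [t..<Suc (t + a)] = subst t (g @ [t]) [t..<t + length (g @ [t])]"
          using subst_append_param[OF s, of h] g by (simp del: upt_Suc)
        then have "subst t (g @ t # h) [t..<Suc (t + a)] = g @ [t]"
          unfolding subst_upt .
        moreover have "subst t (g @ t # h) (map s u) = subst (Suc t) h u"
          using g by (auto simp: subst_def s_def nth_append nth_Cons' not_less less_Suc_eq)
        ultimately show ?thesis by (simp add: w'_def subst_append del: upt_Suc)
      qed
      show "\<exists>w \<in> pwords t (t + m) n. \<forall>g h h'. length g < Suc a \<longrightarrow> set g \<subseteq> {..<t} \<longrightarrow>
          g @ t # h \<in> pwords t k m \<longrightarrow> g @ t # h' \<in> pwords t k m \<longrightarrow>
            \<chi> (subst t (g @ t # h) w) = \<chi> (subst t (g @ t # h') w)"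
      proof (intro bexI allI impI)
        show "subst t w' w \<in> pwords t (t + m) n" by (rule subst_pwords[OF w w'])
        fix g h h' assume g: "length g < Suc a" "set g \<subseteq> {..<t}"
          and h: "g @ t # h \<in> pwords t k m" and h': "g @ t # h' \<in> pwords t k m"
        have "\<chi> (subst t (subst t (g @ t # h) w') w) = \<chi> (subst t (subst t (g @ t # h') w') w)"
        proof (cases "length g = a")
          case True
          have "h \<in> pwords (Suc t) k q" "h' \<in> pwords (Suc t) k q"
            using h h' g True by (auto simp: pwords_compose q_def)
          then have "vec (\<lambda>g. \<chi> (subst t (g @ t # subst (Suc t) h u) w)) gs =
              vec (\<lambda>g. \<chi> (subst t (g @ t # subst (Suc t) h' u) w)) gs"
            using uc by simp
          moreover have "g \<in> set gs" using gs g True by (simp add: pwords_same)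
          ultimately show ?thesis unfolding sw[OF True] by (rule vec_eqD)
        next
          \<comment> \<open>The word \<open>w'\<close> begins with \<open>t, ..., t + a\<close>, so
            \<open>g\<close> and the letter \<open>t\<close> after it survive the substitution, and
            the choice of \<open>w\<close> applies.\<close>
          case False
          then have l: "length g < a" using g by simp
          have "[t..<Suc (t + a)] = [t..<t + length g] @ (t + length g) # [Suc (t + length g)..<Suc (t + a)]"
            using l upt_add_eq_append[of t "t + length g" "Suc (a - length g)"] by (simp add: upt_conv_Cons)
          moreover have "takeWhile (\<lambda>i. i < t + length g) ([t..<t + length g] @ (t + length g) # z) =
              [t..<t + length g]" for z
            by (subst takeWhile_append2) auto
          ultimately have "takeWhile (\<lambda>i. i < t + length g) w' = [t..<t + length g]"
            unfolding w'_def by (simp del: upt_Suc)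
          then have p: "subst t g (takeWhile (\<lambda>i. i < t + length g) w') = g"
            by (simp add: subst_upt)
          have len: "length (g @ t # h) = m" "length (g @ t # h') = m" using h h' by (auto simp: pwords_def)
          obtain h1 where h1: "subst t (g @ t # h) w' = g @ t # h1"
            by (rule subst_split[OF w' len(1), unfolded p])
          obtain h2 where h2: "subst t (g @ t # h') w' = g @ t # h2"
            by (rule subst_split[OF w' len(2), unfolded p])
          show ?thesis
            using ww[OF l g(2)] subst_pwords[OF w' h] subst_pwords[OF w' h'] unfolding h1 h2 .
        qed
        then show "\<chi> (subst t (g @ t # h) (subst t w' w)) = \<chi> (subst t (g @ t # h') (subst t w' w))"
          using subst_subst[of w t w' n] w w' by (simp add: pwords_def)
      qed
    qed
  qed
qed

section \<open>Dependence on the length alone\<close>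

text \<open>Induction on the number of parameters, with the longest prefix treated first. The
  Hales-Jewett theorem provides a \<open>v\<close> whose fillings all have one colour, which settles
  level \<open>m\<close>; the lower levels come from the induction hypothesis for a colouring by
  prefixes of \<open>v\<close>.\<close>

lemma level_canonical:
  fixes S :: "nat set"
  assumes S: "finite S"
  shows "\<exists>n. \<forall>\<chi> \<in> lists {..<t} \<rightarrow> S. \<exists>w \<in> pwords t (t + m) n. \<forall>j<m.
    \<forall>g \<in> pwords t t j. \<forall>g' \<in> pwords t t j.
      \<chi> (subst t g (takeWhile (\<lambda>i. i < t + j) w)) = \<chi> (subst t g' (takeWhile (\<lambda>i. i < t + j) w))"
proof (induction m)
  case 0
  show ?case using pwords_upt[of t t] by auto
next
  case (Suc m)
  obtain l where l: "\<forall>\<chi> \<in> lists {..<t} \<rightarrow> S. \<exists>w \<in> pwords t (t + m) l. \<forall>j<m.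
    \<forall>g \<in> pwords t t j. \<forall>g' \<in> pwords t t j.
      \<chi> (subst t g (takeWhile (\<lambda>i. i < t + j) w)) = \<chi> (subst t g' (takeWhile (\<lambda>i. i < t + j) w))"
    using Suc.IH ..
  obtain n where n: "\<forall>\<chi> \<in> pwords t t n \<rightarrow> S. \<exists>w \<in> pwords t (t + l) n. \<exists>c.
      \<forall>f \<in> pwords t t l. \<chi> (subst t f w) = c"
    using graham_rothschildD[OF hales_jewett S] ..
  show ?case
  proof (intro exI[of _ "Suc n"] ballI)
    fix \<chi> assume \<chi>: "\<chi> \<in> lists {..<t} \<rightarrow> S"
    then have "\<chi> \<in> pwords t t n \<rightarrow> S" by (auto simp: pwords_same lists_eq_set)
    from bspec[OF n this] obtain v c where v: "v \<in> pwords t (t + l) n"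
      and c: "\<And>f. f \<in> pwords t t l \<Longrightarrow> \<chi> (subst t f v) = c" by blast
    \<comment> \<open>A word \<open>g\<close> fills the part of \<open>v\<close> before the first
      parameter that \<open>g\<close> gives no value to.\<close>
    define \<chi>' where "\<chi>' g = \<chi> (subst t g (takeWhile (\<lambda>i. i < t + length g) v))" for g
    have "\<chi>' \<in> lists {..<t} \<rightarrow> S"
    proof
      fix g assume "g \<in> lists {..<t}"
      then have "set (subst t g (takeWhile (\<lambda>i. i < t + length g) v)) \<subseteq> {..<t + 0}"
        by (intro set_subst_less) (auto dest: set_takeWhileD)
      then show "\<chi>' g \<in> S" using \<chi> by (auto simp: \<chi>'_def lists_eq_set)
    qed
    from bspec[OF l this] obtain w where w: "w \<in> pwords t (t + m) l"
      and ww: "\<And>j g g'. j < m \<Longrightarrow> g \<in> pwords t t j \<Longrightarrow> g' \<in> pwords t t j \<Longrightarrow>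
        \<chi>' (subst t g (takeWhile (\<lambda>i. i < t + j) w)) = \<chi>' (subst t g' (takeWhile (\<lambda>i. i < t + j) w))"
      by blast
    \<comment> \<open>The appended letter only marks the end of level \<open>m\<close>: the prefix
      before \<open>t + m\<close> is all of \<open>subst t w v\<close>.\<close>
    let ?w = "subst t w v @ [t + m]"
    have wv: "subst t w v \<in> pwords t (t + m) n" by (rule subst_pwords[OF v w])
    have len: "length w = l" using w by (simp add: pwords_def)
    show "\<exists>w \<in> pwords t (t + Suc m) (Suc n). \<forall>j<Suc m.
      \<forall>g \<in> pwords t t j. \<forall>g' \<in> pwords t t j.
        \<chi> (subst t g (takeWhile (\<lambda>i. i < t + j) w)) = \<chi> (subst t g' (takeWhile (\<lambda>i. i < t + j) w))"
    proof (intro bexI allI impI ballI)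
      show "?w \<in> pwords t (t + Suc m) (Suc n)"
        using wv pword_append[of t "t + m" "subst t w v" "Suc (t + m)" "[t + m]"]
        by (auto simp: pwords_def)
      fix j g g' assume j: "j < Suc m" and g: "g \<in> pwords t t j" "g' \<in> pwords t t j"
      show "\<chi> (subst t g (takeWhile (\<lambda>i. i < t + j) ?w)) = \<chi> (subst t g' (takeWhile (\<lambda>i. i < t + j) ?w))"
      proof (cases "j = m")
        case True
        have e: "takeWhile (\<lambda>i. i < t + j) ?w = subst t w v"
          using pwords_less[OF wv] True by (simp add: takeWhile_append2)
        have "\<chi> (subst t f (takeWhile (\<lambda>i. i < t + j) ?w)) = c" if "f \<in> pwords t t j" for f
          using c[of "subst t f w"] subst_pwords[OF w, of f t] that True subst_subst[of v t w n f] v len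
          unfolding e by simp
        then show ?thesis using g by simp
      next
        case False
        then have j: "j < m" using j by simp
        let ?u = "takeWhile (\<lambda>i. i < t + j) w"
        have "takeWhile (\<lambda>i. i < t + j) ?w = takeWhile (\<lambda>i. i < t + j) (subst t w v)"
          by (rule takeWhile_tail) (use j in simp)
        also have "\<dots> = subst t ?u (takeWhile (\<lambda>i. i < t + length ?u) v)"
          by (rule takeWhile_subst[OF v w j])
        finally have e: "takeWhile (\<lambda>i. i < t + j) ?w = subst t ?u (takeWhile (\<lambda>i. i < t + length ?u) v)" .
        have "\<chi> (subst t f (takeWhile (\<lambda>i. i < t + j) ?w)) = \<chi>' (subst t f ?u)" for f
        proof -
          have "subst t f (subst t ?u (takeWhile (\<lambda>i. i < t + length ?u) v)) =
              subst t (subst t f ?u) (takeWhile (\<lambda>i. i < t + length ?u) v)"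
            by (auto simp: subst_def dest!: set_takeWhileD)
          then show ?thesis by (simp add: e \<chi>'_def)
        qed
        then show ?thesis using ww[OF j g] by simp
      qed
    qed
  qed
qed

text \<open>The length of the prefix is the position of the first \<open>t + j\<close>. So put the
  parameters in order at positions satisfying \<open>P\<close> and the letter \<open>0\<close>,
  available because \<open>0 < t\<close>, elsewhere.\<close>

lemma pword_select:
  assumes "0 < t" "m \<le> card {j. j < L \<and> P j}"
  shows "\<exists>w \<in> pwords t (t + m) L. \<forall>j<m. P (length (takeWhile (\<lambda>i. i < t + j) w))"
  using assms(2)
proof (induction L arbitrary: m)
  case 0
  then show ?case by (auto simp: pwords_def)
next
  case (Suc L)
  have c: "{j. j < Suc L \<and> P j} = (if P L then insert L {j. j < L \<and> P j} else {j. j < L \<and> P j})"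
    by (auto simp: less_Suc_eq)
  have keep: "takeWhile (\<lambda>i. i < t + j) (w @ [x]) = takeWhile (\<lambda>i. i < t + j) w"
    if w: "w \<in> pwords t (t + m) L" and "j < m" for w m j x
  proof -
    obtain z where "w = takeWhile (\<lambda>i. i < t + j) w @ (t + j) # z"
      using pwords_takeWhile[OF w \<open>j < m\<close>] by blast
    then have "t + j \<in> set w" by (metis in_set_conv_decomp)
    then show ?thesis by (intro takeWhile_append1[of "t + j"]) auto
  qed
  show ?case
  proof (cases "m \<le> card {j. j < L \<and> P j}")
    case True
    then obtain w where w: "w \<in> pwords t (t + m) L" "\<forall>j<m. P (length (takeWhile (\<lambda>i. i < t + j) w))"
      using Suc.IH by blast
    have "w @ [0] \<in> pwords t (t + m) (Suc L)"
      using w(1) pword_append[of t "t + m" w "t + m" "[0]"] assms(1) by (auto simp: pwords_def)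
    then show ?thesis using w(2) keep[OF w(1)] by (intro bexI[of _ "w @ [0]"]) auto
  next
    case False
    then obtain m' where m: "m = Suc m'" "m' \<le> card {j. j < L \<and> P j}" and L: "P L"
      using Suc.prems by (cases m) (auto simp: c split: if_splits)
    obtain w where w: "w \<in> pwords t (t + m') L" "\<forall>j<m'. P (length (takeWhile (\<lambda>i. i < t + j) w))"
      using Suc.IH[OF m(2)] by blast
    have "takeWhile (\<lambda>i. i < t + m') (w @ [t + m']) = w"
      using pwords_less[OF w(1)] by (simp add: takeWhile_append2)
    moreover have "length w = L" using w(1) by (simp add: pwords_def)
    moreover have "w @ [t + m'] \<in> pwords t (t + m) (Suc L)"
      using w(1) pword_append[of t "t + m'" w "Suc (t + m')" "[t + m']"] by (auto simp: pwords_def m)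
    ultimately show ?thesis using w(2) keep[OF w(1)] L
      by (intro bexI[of _ "w @ [t + m']"]) (auto simp: m less_Suc_eq)
  qed
qed

text \<open>The word sought is a composite: \<open>w1\<close> removes the dependence on
  \<open>h\<close>, \<open>w2\<close> the dependence on \<open>g\<close> beyond its length, and
  \<open>w3\<close> keeps only lengths of one colour.\<close>

theorem graham_rothschild: "t \<le> k \<Longrightarrow> graham_rothschild t k"
proof (induction "k - t" arbitrary: t)
  case 0
  then show ?case using hales_jewett by simp
next
  case (Suc d)
  then have tk: "t < k" and IH: "graham_rothschild (Suc t) k" by auto
  show ?case
    unfolding graham_rothschild_def
  proof (intro allI impI)
    fix m and S :: "nat set" assume S: "finite S"
    show "\<exists>n. \<forall>\<chi> \<in> pwords t k n \<rightarrow> S. \<exists>w \<in> pwords t (t + m) n. \<exists>c.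
        \<forall>f \<in> pwords t k m. \<chi> (subst t f w) = c"
    \<comment> \<open>The empty alphabet has no letter to fill positions with, but there
      \<open>g\<close> is empty and independence of \<open>h\<close> is enough.\<close>
    proof (cases "t = 0")
      case True
      obtain n where n: "\<forall>\<chi> \<in> pwords t k n \<rightarrow> S. \<exists>w \<in> pwords t (t + m) n. \<forall>g h h'.
          length g < Suc 0 \<longrightarrow> set g \<subseteq> {..<t} \<longrightarrow> g @ t # h \<in> pwords t k m \<longrightarrow> g @ t # h' \<in> pwords t k m \<longrightarrow>
            \<chi> (subst t (g @ t # h) w) = \<chi> (subst t (g @ t # h') w)"
        using prefix_canonical[OF tk IH S] ..
      show ?thesis
      proof (intro exI[of _ n] ballI)
        fix \<chi> assume "\<chi> \<in> pwords t k n \<rightarrow> S"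
        from bspec[OF n this] obtain w where w: "w \<in> pwords t (t + m) n"
          and ww: "\<forall>g h h'. length g < Suc 0 \<longrightarrow> set g \<subseteq> {..<t} \<longrightarrow> g @ t # h \<in> pwords t k m \<longrightarrow>
            g @ t # h' \<in> pwords t k m \<longrightarrow> \<chi> (subst t (g @ t # h) w) = \<chi> (subst t (g @ t # h') w)"
          by blast
        have "\<exists>h. f = t # h" if f: "f \<in> pwords t k m" for f
          by (rule pwords_decompose[OF f tk]) (auto simp: True)
        note head = this
        have "\<chi> (subst t f w) = \<chi> (subst t f' w)"
          if f: "f \<in> pwords t k m" "f' \<in> pwords t k m" for f f'
        proof -
          obtain h h' where "f = t # h" "f' = t # h'" using head f by blast
          then show ?thesis using ww[rule_format, of "[]" h h'] f by simp
        qed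
        then show "\<exists>w \<in> pwords t (t + m) n. \<exists>c. \<forall>f \<in> pwords t k m. \<chi> (subst t f w) = c"
          using w by blast
      qed
    next
      case False
      \<comment> \<open>The colouring by levels is defined on all words; \<open>0\<close> is the
        colour of a \<open>g\<close> without continuation.\<close>
      define S' where "S' = insert 0 S"
      have S': "finite S'" "S' \<noteq> {}" using S by (auto simp: S'_def)
      \<comment> \<open>Among this many lengths some colour occurs at least \<open>m\<close>
        times.\<close>
      define L where "L = m * card S'"
      obtain l where l: "\<forall>\<chi> \<in> lists {..<t} \<rightarrow> S'. \<exists>w \<in> pwords t (t + L) l. \<forall>j<L.
          \<forall>g \<in> pwords t t j. \<forall>g' \<in> pwords t t j.
            \<chi> (subst t g (takeWhile (\<lambda>i. i < t + j) w)) = \<chi> (subst t g' (takeWhile (\<lambda>i. i < t + j) w))"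
        using level_canonical[OF S'(1)] ..
      obtain n where n: "\<forall>\<chi> \<in> pwords t k n \<rightarrow> S. \<exists>w \<in> pwords t (t + l) n. \<forall>g h h'.
          length g < l \<longrightarrow> set g \<subseteq> {..<t} \<longrightarrow> g @ t # h \<in> pwords t k l \<longrightarrow> g @ t # h' \<in> pwords t k l \<longrightarrow>
            \<chi> (subst t (g @ t # h) w) = \<chi> (subst t (g @ t # h') w)"
        using prefix_canonical[OF tk IH S] ..
      show ?thesis
      proof (intro exI[of _ n] ballI)
        fix \<chi> assume \<chi>: "\<chi> \<in> pwords t k n \<rightarrow> S"
        from bspec[OF n this] obtain w1 where w1: "w1 \<in> pwords t (t + l) n"
          and ww1: "\<And>g h h'. length g < l \<Longrightarrow> set g \<subseteq> {..<t} \<Longrightarrow> g @ t # h \<in> pwords t k l \<Longrightarrow>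
            g @ t # h' \<in> pwords t k l \<Longrightarrow>
            \<chi> (subst t (g @ t # h) w1) = \<chi> (subst t (g @ t # h') w1)"
          by blast
        define c where "c g = (if \<exists>h. g @ t # h \<in> pwords t k l
          then \<chi> (subst t (g @ t # (SOME h. g @ t # h \<in> pwords t k l)) w1) else 0)" for g
        have c: "\<chi> (subst t (g @ t # h) w1) = c g"
          if "set g \<subseteq> {..<t}" "g @ t # h \<in> pwords t k l" for g h
        proof -
          have "length g < l" using that(2) by (auto simp: pwords_def)
          moreover have "g @ t # (SOME h. g @ t # h \<in> pwords t k l) \<in> pwords t k l"
            using that(2) by (rule someI)
          ultimately show ?thesis using ww1[of g h] that by (auto simp: c_def)
        qed
        have "c g \<in> S'" for g
        proof (cases "\<exists>h. g @ t # h \<in> pwords t k l")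
          case True
          then have "g @ t # (SOME h. g @ t # h \<in> pwords t k l) \<in> pwords t k l" by (rule someI_ex)
          then show ?thesis using funcset_mem[OF \<chi> subst_pwords[OF w1]] True by (simp add: c_def S'_def)
        qed (simp add: c_def S'_def)
        note cS = this
        then have "c \<in> lists {..<t} \<rightarrow> S'" by simp
        from bspec[OF l this] obtain w2 where w2: "w2 \<in> pwords t (t + L) l"
          and ww2: "\<And>j g g'. j < L \<Longrightarrow> g \<in> pwords t t j \<Longrightarrow> g' \<in> pwords t t j \<Longrightarrow>
            c (subst t g (takeWhile (\<lambda>i. i < t + j) w2)) = c (subst t g' (takeWhile (\<lambda>i. i < t + j) w2))"
          by blast
        \<comment> \<open>The colour of level \<open>j\<close>, evaluated at the word of
          \<open>j\<close> letters \<open>0\<close>, which exists because \<open>t\<close> is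
          positive.\<close>
        define d where "d j = c (subst t (replicate j 0) (takeWhile (\<lambda>i. i < t + j) w2))" for j
        have "\<exists>y\<in>S'. card (d -` {y} \<inter> {..<L}) * card S' \<ge> card {..<L}"
          by (rule pigeonhole_card) (use S' cS in \<open>auto simp: d_def\<close>)
        moreover have "card S' \<noteq> 0" using S' by simp
        ultimately obtain e where "m \<le> card (d -` {e} \<inter> {..<L})" by (auto simp: L_def)
        moreover have "d -` {e} \<inter> {..<L} = {j. j < L \<and> d j = e}" by auto
        ultimately obtain w3 where w3: "w3 \<in> pwords t (t + m) L"
          and ww3: "\<And>j. j < m \<Longrightarrow> d (length (takeWhile (\<lambda>i. i < t + j) w3)) = e"
          using pword_select[of t m L "\<lambda>j. d j = e"] False by auto
        let ?w = "subst t (subst t w3 w2) w1"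
        have w32: "subst t w3 w2 \<in> pwords t (t + m) l" by (rule subst_pwords[OF w2 w3])
        have "\<chi> (subst t f ?w) = e" if f: "f \<in> pwords t k m" for f
        proof -
          obtain g h where gh: "f = g @ t # h" "set g \<subseteq> {..<t}"
            using pwords_decompose[OF f tk] by blast
          have lf: "length (g @ t # h) = m" using f gh by (simp add: pwords_def)
          \<comment> \<open>Follow the prefix through the substitutions: \<open>g\<close> becomes
            \<open>g3\<close>, whose length was selected by \<open>w3\<close>, and then
            \<open>g2\<close>, whose colour depends on that length only.\<close>
          define g3 where "g3 = subst t g (takeWhile (\<lambda>i. i < t + length g) w3)"
          obtain h3 where f3: "subst t f w3 = g3 @ t # h3"
            unfolding gh(1) g3_def by (rule subst_split[OF w3 lf])
          have "set g3 \<subseteq> {..<t + 0}"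
            unfolding g3_def using gh(2) by (intro set_subst_less) (auto dest: set_takeWhileD)
          have f3': "g3 @ t # h3 \<in> pwords t k L" using subst_pwords[OF w3 f] f3 by simp
          then have lf3: "length (g3 @ t # h3) = L" by (simp add: pwords_def)
          define g2 where "g2 = subst t g3 (takeWhile (\<lambda>i. i < t + length g3) w2)"
          obtain h2 where f2: "subst t (g3 @ t # h3) w2 = g2 @ t # h2"
            unfolding g2_def by (rule subst_split[OF w2 lf3])
          have g2: "set g2 \<subseteq> {..<t + 0}"
            unfolding g2_def using \<open>set g3 \<subseteq> {..<t + 0}\<close> by (intro set_subst_less) (auto dest: set_takeWhileD)
          have f2': "g2 @ t # h2 \<in> pwords t k l" using subst_pwords[OF w2 f3'] f2 by simp
          have "c g2 = d (length g3)"
            unfolding g2_def d_def using \<open>set g3 \<subseteq> {..<t + 0}\<close> lf3 False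
            by (intro ww2) (auto simp: pwords_same)
          also have "\<dots> = e" using ww3[of "length g"] lf by (auto simp: g3_def)
          finally have "\<chi> (subst t (g2 @ t # h2) w1) = e" using c[OF _ f2'] g2 by simp
          moreover have "subst t f ?w = subst t (g2 @ t # h2) w1"
            using subst_subst[of w1 t "subst t w3 w2" n f] subst_subst[of w2 t w3 l f] w1 w2 w3 w32 f3 f2
            by (simp add: pwords_def)
          ultimately show ?thesis by simp
        qed
        then show "\<exists>w \<in> pwords t (t + m) n. \<exists>c. \<forall>f \<in> pwords t k m. \<chi> (subst t f w) = c"
          using subst_pwords[OF w1 w32] by blast
      qed
    qed
  qed
qed

subsection \<open>Rigid surjections and sums of arcs\<close>

text \<open>The minimum of the fibre of \<open>p\<close> is the required \<open>v'\<close>;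
  conversely, taking for \<open>v\<close> the minimum of a fibre gives the condition on minima. In
  this form no minima have to be computed.\<close>

lemma rigid_surjection_iff:
  assumes X: "strict_chain X r" "finite X"
  shows "rigid_surjection X r Y s f \<longleftrightarrow> f ` X = Y \<and>
    (\<forall>v \<in> X. \<forall>p \<in> Y. (p, f v) \<in> s \<longrightarrow> (\<exists>v' \<in> X. f v' = p \<and> (v', v) \<in> r))"
    (is "?L \<longleftrightarrow> ?R")
proof -
  let ?m = "\<lambda>y. chain_min r {u \<in> X. f u = y}"
  have tr: "\<And>x y z. (x, y) \<in> r \<Longrightarrow> (y, z) \<in> r \<Longrightarrow> (x, z) \<in> r"
    using X unfolding strict_chain_def strict_linear_order_on_def trans_def by blast
  have m: "?m y \<in> X" "f (?m y) = y" "\<And>u. u \<in> X \<Longrightarrow> f u = y \<Longrightarrow> ?m y = u \<or> (?m y, u) \<in> r"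
    "\<And>u a. u \<in> X \<Longrightarrow> f u = y \<Longrightarrow> (a, ?m y) \<in> r \<Longrightarrow> (a, u) \<in> r"
    if "f ` X = Y" "y \<in> Y" for y
  proof -
    have S: "finite {u \<in> X. f u = y}" "{u \<in> X. f u = y} \<noteq> {}" "{u \<in> X. f u = y} \<subseteq> X"
      using that X(2) by auto
    show "?m y \<in> X" "f (?m y) = y" using chain_min_props(1)[OF X(1) S] by auto
    show c: "?m y = u \<or> (?m y, u) \<in> r" if "u \<in> X" "f u = y" for u
      using chain_min_props(2)[OF X(1) S, of u] that by blast
    show "(a, u) \<in> r" if "u \<in> X" "f u = y" "(a, ?m y) \<in> r" for a u
      using c[OF that(1,2)] that(3) by (elim disjE) (auto intro: tr)
  qed
  show ?thesis
  proof
    assume L: ?L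
    then have Y: "f ` X = Y" by (simp add: rigid_surjection_def)
    show ?R
    proof (intro conjI ballI impI Y)
      fix v p assume v: "v \<in> X" "p \<in> Y" "(p, f v) \<in> s"
      then have fv: "f v \<in> Y" using Y by blast
      then have "(?m p, ?m (f v)) \<in> r" using L v unfolding rigid_surjection_def by blast
      then have "(?m p, v) \<in> r" by (rule m(4)[OF Y fv v(1) refl])
      then show "\<exists>v' \<in> X. f v' = p \<and> (v', v) \<in> r" using m[OF Y v(2)] by blast
    qed
  next
    assume R: ?R
    show ?L
      unfolding rigid_surjection_def
    proof (intro conjI ballI impI)
      show Y: "f ` X = Y" using R by blast
      fix x y assume xy: "x \<in> Y" "y \<in> Y" "(x, y) \<in> s"
      have "(x, f (?m y)) \<in> s" using xy m(2)[OF Y xy(2)] by simp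
      then obtain v where v: "v \<in> X" "f v = x" "(v, ?m y) \<in> r"
        using R m(1)[OF Y xy(2)] xy(1) by blast
      show "(?m x, ?m y) \<in> r" using m(3)[OF Y xy(1) v(1,2)] v(3) tr[of "?m x" v "?m y"] by auto
    qed
  qed
qed

section \<open>Enumerations of finite chains\<close>

definition chain_enum :: "'a set \<Rightarrow> 'a rel \<Rightarrow> (nat \<Rightarrow> 'a) \<Rightarrow> bool" where
  "chain_enum X r \<beta> \<longleftrightarrow> bij_betw \<beta> {..<card X} X \<and>
    (\<forall>i<card X. \<forall>j<card X. (\<beta> i, \<beta> j) \<in> r \<longleftrightarrow> i < j)"

lemma chain_enum_surj: "chain_enum X r \<beta> \<Longrightarrow> x \<in> X \<Longrightarrow> \<exists>i<card X. \<beta> i = x"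
  unfolding chain_enum_def bij_betw_def by (metis imageE lessThan_iff)

lemma ex_chain_enum:
  assumes X: "strict_chain X r" "finite X"
  shows "\<exists>\<beta>. chain_enum X r \<beta>"
proof -
  \<comment> \<open>The rank, that is, the number of predecessors, is strictly monotone; its inverse
    is the enumeration.\<close>
  define \<rho> where "\<rho> x = card {y \<in> X. (y, x) \<in> r}" for x
  have tr: "\<And>x y z. (x, y) \<in> r \<Longrightarrow> (y, z) \<in> r \<Longrightarrow> (x, z) \<in> r" and irr: "\<And>x. (x, x) \<notin> r"
    and tot: "\<And>x y. x \<in> X \<Longrightarrow> y \<in> X \<Longrightarrow> x \<noteq> y \<Longrightarrow> (x, y) \<in> r \<or> (y, x) \<in> r"
    using X unfolding strict_chain_def strict_linear_order_on_def trans_def irrefl_def total_on_def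
    by blast+
  have mono: "\<rho> x < \<rho> y" if "x \<in> X" "(x, y) \<in> r" for x y
  proof -
    have "x \<in> {u \<in> X. (u, y) \<in> r}" "x \<notin> {u \<in> X. (u, x) \<in> r}"
      "{u \<in> X. (u, x) \<in> r} \<subseteq> {u \<in> X. (u, y) \<in> r}"
      using that tr irr by auto
    then have "{u \<in> X. (u, x) \<in> r} \<subset> {u \<in> X. (u, y) \<in> r}" by blast
    then show ?thesis unfolding \<rho>_def using X(2) by (intro psubset_card_mono) auto
  qed
  have less_iff: "(x, y) \<in> r \<longleftrightarrow> \<rho> x < \<rho> y" if "x \<in> X" "y \<in> X" for x y
    using that mono[of x y] mono[of y x] tot[of x y] irr[of x] by (cases "x = y") auto
  have inj: "inj_on \<rho> X"
    using mono tot unfolding inj_on_def by (metis less_irrefl)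
  have "\<rho> x < card X" if "x \<in> X" for x
    unfolding \<rho>_def by (rule psubset_card_mono) (use that X irr in auto)
  then have "\<rho> ` X = {..<card X}"
    by (intro card_subset_eq) (auto simp: card_image[OF inj])
  then have bij: "bij_betw \<rho> X {..<card X}" using inj by (simp add: bij_betw_def)
  have "(inv_into X \<rho> i, inv_into X \<rho> j) \<in> r \<longleftrightarrow> i < j" if "i < card X" "j < card X" for i j
  proof -
    have "inv_into X \<rho> i \<in> X" "inv_into X \<rho> j \<in> X" "\<rho> (inv_into X \<rho> i) = i" "\<rho> (inv_into X \<rho> j) = j"
      using that bij by (auto simp: bij_betw_def inv_into_into f_inv_into_f)
    then show ?thesis using less_iff by simp
  qed
  then show ?thesis using bij_betw_inv_into[OF bij] unfolding chain_enum_def by blast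
qed

text \<open>Letters before the first \<open>y\<close> are smaller than \<open>y\<close>, so a larger
  one stands after it. This is the converse of the second condition in
  \<open>pwordI\<close>.\<close>

lemma pwordD:
  assumes w: "pword t m w" and i: "i < length w" and y: "t \<le> y" "y < w ! i"
  shows "\<exists>j<i. w ! j = y"
proof -
  have "y < m" using pword_less[OF w nth_mem[OF i]] y by simp
  then obtain u z where z: "w = u @ y # z" "set u \<subseteq> {..<y}" using pword_split[OF w y(1)] by blast
  have "\<not> i \<le> length u"
  proof
    assume "i \<le> length u"
    then consider "i < length u" | "i = length u" by linarith
    then show False
    proof cases
      case 1
      then have "w ! i \<in> set u" using z(1) by (simp add: nth_append)
      then show False using z(2) y(2) by auto
    next
      case 2
      then show False using z(1) y(2) by simp
    qed
  qed
  then show ?thesis using z by (intro exI[of _ "length u"]) auto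
qed

lemma pword_set:
  assumes "pword 0 m w"
  shows "set w = {..<m}"
proof
  show "{..<m} \<subseteq> set w"
  proof
    fix y assume "y \<in> {..<m}"
    then obtain u z where "w = u @ y # z" using pword_split[OF assms, of y] by auto
    then show "y \<in> set w" by simp
  qed
qed (use pword_less[OF assms] in auto)

section \<open>Sums of arcs and the maps given by words\<close>

text \<open>The disjoint union of \<open>n\<close> arcs, carried into the vertex type by
  \<open>e\<close>. Listing the vertices arc by arc makes \<open>sal\<close> order the proper arcs
  by their number.\<close>

definition arc_sum :: "(nat \<Rightarrow> 'a) \<Rightarrow> nat \<Rightarrow> 'a linext_digraph" where
  "arc_sum e n = \<lparr>verts = e ` {..<2 * n},
    arcs = {(e i, e i) | i. i < 2 * n} \<union> {(e (2 * i), e (Suc (2 * i))) | i. i < n},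
    lin = {(e i, e j) | i j. i < j \<and> j < 2 * n}\<rparr>"

lemma finite_arc_sum: "finite (verts (arc_sum e n))"
  by (simp add: arc_sum_def)

lemma poset_linext_arc_sum:
  assumes e: "inj e"
  shows "poset_linext (arc_sum e n)"
proof -
  have [simp]: "e i = e j \<longleftrightarrow> i = j" for i j using e by (simp add: inj_eq)
  \<comment> \<open>By parity no vertex is both the end and the start of a proper arc, so proper
    arcs are never composed.\<close>
  have odd: "2 * i \<noteq> Suc (2 * j)" "Suc (2 * j) \<noteq> 2 * i" for i j by presburger+
  have "strict_chain (verts (arc_sum e n)) (lin (arc_sum e n))"
    unfolding strict_chain_def strict_linear_order_on_def trans_def irrefl_def total_on_def
    by (auto simp: arc_sum_def)
  moreover have "arcs (arc_sum e n) \<subseteq> verts (arc_sum e n) \<times> verts (arc_sum e n)"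
    by (auto simp: arc_sum_def)
  moreover have "refl_on (verts (arc_sum e n)) (arcs (arc_sum e n))"
    by (auto simp: arc_sum_def refl_on_def)
  moreover have "trans (arcs (arc_sum e n))"
    by (auto simp: arc_sum_def trans_def odd)
  moreover have "antisym (arcs (arc_sum e n))"
    by (auto simp: arc_sum_def antisym_def odd)
  moreover have "\<forall>x y. (x, y) \<in> arcs (arc_sum e n) \<and> x \<noteq> y \<longrightarrow> (x, y) \<in> lin (arc_sum e n)"
    by (auto simp: arc_sum_def)
  ultimately show ?thesis
    unfolding poset_linext_def reflexive_digraph_linext_def partial_order_on_def preorder_on_def
    by blast
qed

text \<open>Even indices are sources and odd ones targets, so halving the index of a vertex gives
  the position of its letter.\<close>

definition word_map :: "(nat \<Rightarrow> 'a) \<Rightarrow> (nat \<Rightarrow> 'b \<times> 'b) \<Rightarrow> nat list \<Rightarrow> 'a \<Rightarrow> 'b" where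
  "word_map e \<beta> w = restrict
    (\<lambda>v. (if even (inv e v) then fst else snd) (\<beta> (w ! (inv e v div 2)))) (e ` {..<2 * length w})"

lemma word_map_apply:
  assumes "inj e" "i < length w"
  shows "word_map e \<beta> w (e (2 * i)) = fst (\<beta> (w ! i))"
    "word_map e \<beta> w (e (Suc (2 * i))) = snd (\<beta> (w ! i))"
  using assms by (auto simp: word_map_def)

text \<open>By \<open>rigid_surjection_iff\<close>, whatever precedes an image must be the image of
  an earlier arc. For proper arcs this is the condition on first occurrences in the word; for loops
  it follows because loops come first in \<open>sal B\<close>.\<close>

lemma strong_rigid_quotient_word_map:
  assumes e: "inj e" and B: "finite (verts B)" "reflexive_digraph_linext B"
    and \<beta>: "chain_enum (arcs B) (sal B) \<beta>" and w: "w \<in> pwords 0 (card (arcs B)) n"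
  shows "strong_rigid_quotient (arc_sum e n) B (word_map e \<beta> w)"
proof -
  let ?G = "arc_sum e n" and ?f = "word_map e \<beta> w"
  define u where "u i = \<beta> (w ! i)" for i
  have [simp]: "e i = e j \<longleftrightarrow> i = j" for i j using e by (simp add: inj_eq)
  have len: "length w = n" and pw: "pword 0 (card (arcs B)) w" using w by (auto simp: pwords_def)
  have G: "reflexive_digraph_linext ?G" using poset_linext_arc_sum[OF e] by (simp add: poset_linext_def)
  have sub: "arcs B \<subseteq> verts B \<times> verts B" and rfl: "\<And>x. x \<in> verts B \<Longrightarrow> (x, x) \<in> arcs B"
    using B by (auto simp: reflexive_digraph_linext_def refl_on_def)
  have bij: "bij_betw \<beta> {..<card (arcs B)} (arcs B)" using \<beta> by (simp add: chain_enum_def)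
  have f: "?f (e (2 * i)) = fst (u i)" "?f (e (Suc (2 * i))) = snd (u i)" if "i < n" for i
    using word_map_apply[OF e, of i w \<beta>] that len by (auto simp: u_def)
  have u: "u i \<in> arcs B" if "i < n" for i
    using bij pword_less[OF pw] that len by (auto simp: u_def bij_betw_def)
  have fv: "?f (e i) \<in> verts B" if "i < 2 * n" for i
  proof -
    have i: "i div 2 < n" using that by simp
    then have "u (i div 2) \<in> verts B \<times> verts B" using u sub by blast
    then have "?f (e (2 * (i div 2))) \<in> verts B" "?f (e (Suc (2 * (i div 2)))) \<in> verts B"
      using f[OF i] by (auto simp: mem_Times_iff)
    then show ?thesis by (cases "even i") (auto elim!: evenE oddE)
  qed
  have surj: "\<exists>i<n. u i = p" if p: "p \<in> arcs B" for p
  proof -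
    obtain y where "y < card (arcs B)" "\<beta> y = p" using chain_enum_surj[OF \<beta> p] by blast
    moreover obtain i where "i < length w" "w ! i = y"
      using pword_set[OF pw] \<open>y < card (arcs B)\<close> by (metis in_set_conv_nth lessThan_iff)
    ultimately show ?thesis using len by (auto simp: u_def)
  qed
  have first: "\<exists>j<i. u j = p" if p: "p \<in> arcs B" "(p, u i) \<in> sal B" and i: "i < n" for p i
  proof -
    obtain y where y: "y < card (arcs B)" "\<beta> y = p" using chain_enum_surj[OF \<beta> p(1)] by blast
    have "w ! i < card (arcs B)" using pword_less[OF pw] i len by simp
    then have "y < w ! i" using p(2) y \<beta> by (auto simp: u_def chain_enum_def)
    then show ?thesis using pwordD[OF pw, of i y] i len y by (auto simp: u_def)
  qed
  have arcG: "(e (2 * i), e (Suc (2 * i))) \<in> arcs ?G" if "i < n" for i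
    using that by (auto simp: arc_sum_def)
  have loopG: "(e i, e i) \<in> arcs ?G" if "i < 2 * n" for i
    using that by (auto simp: arc_sum_def)
  have linG: "(e i, e j) \<in> lin ?G \<longleftrightarrow> i < j \<and> j < 2 * n" for i j
    by (auto simp: arc_sum_def)
  have hom: "(?f x, ?f y) \<in> arcs B" if xy: "(x, y) \<in> arcs ?G" for x y
  proof -
    consider i where "i < 2 * n" "x = e i" "y = e i"
      | i where "i < n" "x = e (2 * i)" "y = e (Suc (2 * i))"
      using xy by (auto simp: arc_sum_def)
    then show ?thesis using fv rfl f u by cases auto
  qed
  have img: "(\<lambda>(x, y). (?f x, ?f y)) ` arcs ?G = arcs B"
  proof
    show "arcs B \<subseteq> (\<lambda>(x, y). (?f x, ?f y)) ` arcs ?G"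
    proof
      fix p assume "p \<in> arcs B"
      then obtain i where "i < n" "u i = p" using surj by blast
      then show "p \<in> (\<lambda>(x, y). (?f x, ?f y)) ` arcs ?G"
        using arcG[of i] f[of i] by (intro image_eqI[of _ _ "(e (2 * i), e (Suc (2 * i)))"]) auto
    qed
  qed (use hom in auto)
  have "rigid_surjection (arcs ?G) (sal ?G) (arcs B) (sal B) (\<lambda>(x, y). (?f x, ?f y))"
    unfolding rigid_surjection_iff[OF strict_chain_sal[OF G] finite_arcs[OF finite_arc_sum G]]
  proof (intro conjI ballI impI img)
    fix v p assume v: "v \<in> arcs ?G" and p: "p \<in> arcs B"
      and s: "(p, case v of (x, y) \<Rightarrow> (?f x, ?f y)) \<in> sal B"
    consider i where "i < 2 * n" "v = (e i, e i)" | i where "i < n" "v = (e (2 * i), e (Suc (2 * i)))"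
      using v by (auto simp: arc_sum_def)
    then show "\<exists>v' \<in> arcs ?G. (case v' of (x, y) \<Rightarrow> (?f x, ?f y)) = p \<and> (v', v) \<in> sal ?G"
    proof cases
      \<comment> \<open>Only loops precede a loop, so \<open>p\<close> is a loop. It also precedes
        the arc \<open>u i'\<close> at \<open>?x\<close>, be that the loop at \<open>?x\<close> or a
        proper arc, and hence is an earlier letter \<open>u j\<close>. The loop at the source of the
        \<open>j\<close>-th arc is mapped to it.\<close>
      case (1 i)
      define i' where "i' = i div 2"
      have i': "i' < n" using 1 by (simp add: i'_def)
      let ?x = "?f (e i)"
      have x: "?x = fst (u i') \<or> ?x = snd (u i')"
        using f[OF i'] by (cases "even i") (auto simp: i'_def elim!: evenE oddE)
      have s: "(p, (?x, ?x)) \<in> sal B" using s 1 by simp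
      obtain y z where yz: "p = (y, z)" by force
      have xB: "(?x, ?x) \<in> arcs B" using fv rfl 1 by simp
      have y: "z = y" "(y, ?x) \<in> lin B" "(y, y) \<in> arcs B"
        using s p sal_iff[OF B(2) _ xB, of y z] by (auto simp: yz)
      obtain u1 u2 where u12: "u i' = (u1, u2)" by force
      have "(p, u i') \<in> sal B"
        using y x u[OF i'] sal_iff[OF B(2) y(3), of u1 u2] by (auto simp: yz u12)
      then obtain j where j: "j < i'" "u j = p" using first p i' by blast
      let ?v = "(e (2 * j), e (2 * j))"
      have ji: "2 * j < i" using j by (simp add: i'_def)
      have "?v \<in> arcs ?G" by (rule loopG) (use ji 1 in simp)
      moreover have "(?v, v) \<in> sal ?G"
        using sal_iff[OF G loopG loopG, of "2 * j" i] ji 1 by (simp add: linG)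
      ultimately show ?thesis using f[of j] j i' y by (intro bexI[of _ ?v]) (auto simp: yz)
    next
      case (2 i)
      then have "(p, u i) \<in> sal B" using s f by simp
      then obtain j where j: "j < i" "u j = p" using first p 2 by blast
      let ?v = "(e (2 * j), e (Suc (2 * j)))"
      have "?v \<in> arcs ?G" by (rule arcG) (use j 2 in simp)
      moreover have "(?v, v) \<in> sal ?G"
        using sal_iff[OF G arcG arcG, of j i] j 2 by (simp add: linG)
      ultimately show ?thesis using f[of j] j 2 by (intro bexI[of _ ?v]) auto
    qed
  qed
  moreover have "?f \<in> verts ?G \<rightarrow>\<^sub>E verts B"
    using fv by (auto simp: PiE_iff arc_sum_def word_map_def len)
  ultimately show ?thesis using hom unfolding strong_rigid_quotient_def by blast
qed

text \<open>Numbering arcs by rank turns the map on arcs into a word: its \<open>i\<close>-th letter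
  is the rank of the image of the \<open>i\<close>-th arc. Rigidity becomes the criterion of
  \<open>pwordI\<close>.\<close>

lemma strong_rigid_quotient_word:
  assumes A: "finite (verts A)" "reflexive_digraph_linext A" "chain_enum (arcs A) (sal A) \<alpha>"
    and B: "finite (verts B)" "reflexive_digraph_linext B" "chain_enum (arcs B) (sal B) \<beta>"
    and f: "strong_rigid_quotient B A f"
  shows "\<exists>z \<in> pwords 0 (card (arcs A)) (card (arcs B)).
    \<forall>i<card (arcs B). \<alpha> (z ! i) = map_prod f f (\<beta> i)"
proof -
  let ?a = "card (arcs A)" and ?b = "card (arcs B)"
  define \<rho> where "\<rho> = inv_into {..<?a} \<alpha>"
  have bijA: "bij_betw \<alpha> {..<?a} (arcs A)" and bijB: "bij_betw \<beta> {..<?b} (arcs B)"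
    using A B by (auto simp: chain_enum_def)
  have \<rho>: "bij_betw \<rho> (arcs A) {..<?a}" unfolding \<rho>_def by (rule bij_betw_inv_into[OF bijA])
  have \<alpha>\<rho>: "\<alpha> (\<rho> p) = p" if "p \<in> arcs A" for p
    unfolding \<rho>_def using bijA that by (simp add: bij_betw_inv_into_right)
  have \<rho>\<alpha>: "\<rho> (\<alpha> i) = i" if "i < ?a" for i
    unfolding \<rho>_def using bijA that by (simp add: bij_betw_inv_into_left)
  have "map_prod f f = (\<lambda>(x, y). (f x, f y))" by auto
  then have r: "map_prod f f ` arcs B = arcs A" "\<And>v p. v \<in> arcs B \<Longrightarrow> p \<in> arcs A \<Longrightarrow>
      (p, map_prod f f v) \<in> sal A \<Longrightarrow> \<exists>v' \<in> arcs B. map_prod f f v' = p \<and> (v', v) \<in> sal B"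
    using f unfolding strong_rigid_quotient_def
      rigid_surjection_iff[OF strict_chain_sal[OF B(2)] finite_arcs[OF B(1,2)]] by auto
  have \<beta>: "\<beta> i \<in> arcs B" "map_prod f f (\<beta> i) \<in> arcs A" if "i < ?b" for i
    using bijB r(1) that by (auto simp: bij_betw_def)
  define z where "z = map (\<lambda>i. \<rho> (map_prod f f (\<beta> i))) [0..<?b]"
  have "pword 0 ?a z"
  proof (rule pwordI)
    have "set z = \<rho> ` map_prod f f ` \<beta> ` {..<?b}"
      by (auto simp: z_def image_image lessThan_atLeast0)
    also have "\<dots> = {..<?a}" using bijB r(1) \<rho> by (simp add: bij_betw_def)
    finally show "{..<0} \<union> set z = {..<?a}" by simp
  next
    fix i y assume i: "i < length z" and y: "y < z ! i"
    have ib: "i < ?b" using i by (simp add: z_def)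
    let ?q = "map_prod f f (\<beta> i)"
    have q: "\<rho> ?q < ?a" "y < \<rho> ?q" using \<rho> \<beta>[OF ib] y ib by (auto simp: bij_betw_def z_def)
    then have "(\<alpha> y, \<alpha> (\<rho> ?q)) \<in> sal A" using A(3) by (simp add: chain_enum_def)
    moreover have p: "\<alpha> y \<in> arcs A" using bijA q by (auto simp: bij_betw_def)
    ultimately obtain v where v: "v \<in> arcs B" "map_prod f f v = \<alpha> y" "(v, \<beta> i) \<in> sal B"
      using r(2)[OF \<beta>(1)[OF ib] p] \<alpha>\<rho>[OF \<beta>(2)[OF ib]] by auto
    obtain j where j: "j < ?b" "\<beta> j = v" using chain_enum_surj[OF B(3) v(1)] by blast
    then have "j < i" using v(3) ib B(3) by (auto simp: chain_enum_def)
    moreover have "z ! j = y" using j v(2) \<rho>\<alpha>[of y] q by (simp add: z_def)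
    ultimately show "y < 0 \<or> (\<exists>j<i. z ! j = y)" by blast
  qed
  then have "z \<in> pwords 0 ?a ?b" by (simp add: pwords_def z_def)
  moreover have "\<alpha> (z ! i) = map_prod f f (\<beta> i)" if "i < ?b" for i
    using \<alpha>\<rho> \<beta>(2) that by (simp add: z_def)
  ultimately show ?thesis by blast
qed

section \<open>Transfer to the dual Ramsey property\<close>

text \<open>The object \<open>C\<close> is always a sum of arcs, so one argument serves every class
  of objects that contains these sums.\<close>

lemma dual_ramsey_srq:
  fixes Obs :: "'a::infinite linext_digraph set"
  assumes obs: "\<And>A. A \<in> Obs \<Longrightarrow> finite (verts A) \<and> reflexive_digraph_linext A"
    and sums: "\<And>(e :: nat \<Rightarrow> 'a) n. inj e \<Longrightarrow> arc_sum e n \<in> Obs"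
  shows "dual_ramsey \<lparr>Ob = Obs, Hom = (\<lambda>A B. {f. strong_rigid_quotient A B f}),
    Comp = (\<lambda>A B C g f. compose (verts A) g f)\<rparr>"
proof -
  obtain e :: "nat \<Rightarrow> 'a" where e: "inj e"
    using infinite_countable_subset[OF infinite_UNIV] by blast
  have "\<exists>C \<in> Obs. \<forall>\<chi> \<in> {f. strong_rigid_quotient C A f} \<rightarrow> {1..k}.
      \<exists>w \<in> {f. strong_rigid_quotient C B f}. \<exists>c. \<forall>f \<in> {f. strong_rigid_quotient B A f}.
        \<chi> (compose (verts C) f w) = c"
    if "A \<in> Obs" "B \<in> Obs" for A B and k :: nat
  proof -
    note A = obs[OF that(1), THEN conjunct1] obs[OF that(1), THEN conjunct2]
    note B = obs[OF that(2), THEN conjunct1] obs[OF that(2), THEN conjunct2]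
    let ?a = "card (arcs A)" and ?b = "card (arcs B)"
    obtain \<alpha> \<beta> where \<alpha>: "chain_enum (arcs A) (sal A) \<alpha>" and \<beta>: "chain_enum (arcs B) (sal B) \<beta>"
      using ex_chain_enum strict_chain_sal finite_arcs A B by metis
    \<comment> \<open>Over the empty alphabet, words with \<open>?b\<close> parameters give maps
      onto \<open>B\<close> and words with \<open>?a\<close> parameters give maps onto
      \<open>A\<close>.\<close>
    obtain n where n: "\<forall>\<chi> \<in> pwords 0 ?a n \<rightarrow> {1..k}. \<exists>w \<in> pwords 0 (0 + ?b) n. \<exists>c.
        \<forall>f \<in> pwords 0 ?a ?b. \<chi> (subst 0 f w) = c"
      using graham_rothschildD[OF graham_rothschild[of 0 ?a] finite_atLeastAtMost] by blast
    let ?C = "arc_sum e n"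
    show ?thesis
    proof (intro bexI[of _ ?C] ballI)
      show "?C \<in> Obs" by (rule sums[OF e])
      fix \<chi> assume \<chi>: "\<chi> \<in> {f. strong_rigid_quotient ?C A f} \<rightarrow> {1..k}"
      have "(\<lambda>w. \<chi> (word_map e \<alpha> w)) \<in> pwords 0 ?a n \<rightarrow> {1..k}"
        using funcset_mem[OF \<chi>] strong_rigid_quotient_word_map[OF e A \<alpha>] by blast
      from bspec[OF n this] obtain w c where w: "w \<in> pwords 0 ?b n"
        and c: "\<And>z. z \<in> pwords 0 ?a ?b \<Longrightarrow> \<chi> (word_map e \<alpha> (subst 0 z w)) = c" by auto
      show "\<exists>w \<in> {f. strong_rigid_quotient ?C B f}. \<exists>c. \<forall>f \<in> {f. strong_rigid_quotient B A f}.
          \<chi> (compose (verts ?C) f w) = c"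
      proof (intro bexI exI ballI)
        show "word_map e \<beta> w \<in> {f. strong_rigid_quotient ?C B f}"
          using strong_rigid_quotient_word_map[OF e B \<beta> w] by simp
        fix f assume "f \<in> {f. strong_rigid_quotient B A f}"
        then have f: "strong_rigid_quotient B A f" by simp
        obtain z where z: "z \<in> pwords 0 ?a ?b"
          and zf: "\<And>i. i < ?b \<Longrightarrow> \<alpha> (z ! i) = map_prod f f (\<beta> i)"
          using strong_rigid_quotient_word[OF A \<alpha> B \<beta> f] by blast
        \<comment> \<open>Composing with \<open>f\<close> replaces the arc of each letter by its
          image, which is what substituting \<open>z\<close> does to the word.\<close>
        have "compose (verts ?C) f (word_map e \<beta> w) = word_map e \<alpha> (subst 0 z w)"
        proof
          fix v
          show "compose (verts ?C) f (word_map e \<beta> w) v = word_map e \<alpha> (subst 0 z w) v"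
          proof (cases "v \<in> verts ?C")
            case True
            then obtain i where i: "i < 2 * n" "v = e i" by (auto simp: arc_sum_def)
            have l: "i div 2 < length w" "length w = n" using i w by (auto simp: pwords_def)
            then have "w ! (i div 2) < ?b" using pwords_less[OF w] by simp
            then have "\<alpha> (subst 0 z w ! (i div 2)) = map_prod f f (\<beta> (w ! (i div 2)))"
              using zf l by (simp add: subst_def)
            then show ?thesis using i l e
              by (auto simp: compose_def word_map_def arc_sum_def inj_eq)
          next
            case False
            then show ?thesis using w
              by (auto simp: compose_def word_map_def arc_sum_def restrict_def pwords_def)
          qed
        qed
        then show "\<chi> (compose (verts ?C) f (word_map e \<beta> w)) = c" using c[OF z] by simp
      qed
    qed
  qed
  then show ?thesis unfolding dual_ramsey_def by simp
qed

theorem corollary5p5: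
  shows "dual_ramsey (EDig_srq :: ('a::infinite linext_digraph, 'a \<Rightarrow> 'a) cat) \<and>
         dual_ramsey (EPos_srq :: ('a::infinite linext_digraph, 'a \<Rightarrow> 'a) cat)"
  unfolding EDig_srq_def EPos_srq_def
  by (intro conjI dual_ramsey_srq)
    (use poset_linext_arc_sum finite_arc_sum in \<open>auto simp: poset_linext_def\<close>)

end
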